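(* Let the subspaces $\{\mathcal V_j\}$, $\{\mathcal U_j\}$ and points $\{\mu_j\}$ be generated by the two-sided greedy procedure described in the context. Then for every $j\ge 1$ and $i=1,\dots,j$, $$\sigma^{\mathcal V_j}_{\min}(\mu_i)=\sigma_{\min}(\mu_i).$$ Moreover, if $\sigma_{\min}(\mu_i)$ is a simple singular value of $A(\mu_i)$, then $$\sigma^{\mathcal V_j,\mathcal U_j}(\mu_i)=\sigma_{\min}(\mu_i),$$ and if $\sigma_{\min}(\mu_i)$ is simple and nonzero, then $$\nabla\sigma^{\mathcal V_j}_{\min}(\mu_i)=\nabla\sigma_{\min}(\mu_i)\quad\text{and}\quad \nabla\sigma^{\mathcal V_j,\mathcal U_j}(\mu_i)=\nabla\sigma_{\min}(\mu_i).$$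
   Context: Let $\mathcal D\subset\mathbb R^p$ be compact and $A(\mu)=\sum_{m=1}^\kappa\theta_m(\mu)A_m$ with $A_m\in\mathbb C^{n\times n}$ (not necessarily Hermitian) and $\theta_m:\mathbb R^p\to\mathbb R$ real analytic. $\sigma_{\min}(\mu)$ is the smallest singular value of $A(\mu)$, and $\sigma_k(\mu)$ its $k$-th smallest singular value. Fix $\ell\in\mathbb N$, $1\le\ell\le n$. For a parameter $\mu$, $u_k(\mu),v_k(\mu)$ denote consistent unit left and right singular vectors of $A(\mu)$ for $\sigma_k(\mu)$, i.e. $A(\mu)v_k(\mu)=\sigma_k(\mu)u_k(\mu)$ and $u_k(\mu)^*A(\mu)=\sigma_k(\mu)v_k(\mu)^*$, with $v_1(\mu),\dots,v_\ell(\mu)$ orthonormal and $u_1(\mu),\dots,u_\ell(\mu)$ orthonormal. For subspaces $\mathcal V,\mathcal U\subseteq\mathbb C^n$ and matrices $V,U$ whose columns form orthonormal bases of them, define $\sigma^{\mathcal V}_{\min}(\mu)=\sigma_{\min}(A(\mu)V)$ (smallest singular value of $A(\mu)V$), let $v^V_{\mathrm{UB}}(\mu)$ be a unit right singular vector of $A(\mu)V$ corresponding to its smallest singular value, and define $$\sigma^{\mathcal V,\mathcal U}(\mu)=\sqrt{v^V_{\mathrm{UB}}(\mu)^*V^*A(\mu)^*UU^*A(\mu)V\,v^V_{\mathrm{UB}}(\mu)}.$$ Two-sided greedy procedure. Choose $\mu_1\in\mathcal D$, $\mathcal V_1=\mathrm{span}\{v_1(\mu_1),\dots,v_\ell(\mu_1)\}$,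 $\mathcal U_1=\mathrm{span}\{u_1(\mu_1),\dots,u_\ell(\mu_1)\}$. For $j=1,2,\dots$: let $\mu_{j+1}$ be a maximizer over $\mu\in\mathcal D$ of $\sigma^{\mathcal V_j}_{\min}(\mu)-\sigma^{\mathcal V_j,\mathcal U_j}(\mu)$, and set $\mathcal V_{j+1}=\mathcal V_j+\mathrm{span}\{v_1(\mu_{j+1}),\dots,v_\ell(\mu_{j+1})\}$, $\mathcal U_{j+1}=\mathcal U_j+\mathrm{span}\{u_1(\mu_{j+1}),\dots,u_\ell(\mu_{j+1})\}$. *)

theory Defs
  imports "HOL-Analysis.Analysis" "HOL-Library.Multiset"
    "Jordan_Normal_Form.Char_Poly" "Jordan_Normal_Form.Schur_Decomposition"
    "Jordan_Normal_Form.VS_Connect"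
begin

text \<open>
  The number of columns of the basis matrices varies along the iteration, so matrices and
  vectors in \<open>\<complex>\<^sup>n\<close> are those of Jordan_Normal_Form (explicit dimensions).  Parameters live in
  \<open>real ^ 'p\<close>.  Where both libraries use the same name, it is qualified.
\<close>

type_synonym cvec = "complex Matrix.vec"
type_synonym cmat = "complex Matrix.mat"

text \<open>Real analytic: near every point, the (unconditionally convergent) sum of a power series
  in the coordinates of the displacement; \<open>\<alpha>\<close> ranges over all multi-indices.\<close>

definition real_analytic :: "(real ^ 'p \<Rightarrow> real) \<Rightarrow> bool" where
  "real_analytic f \<longleftrightarrow>
     (\<forall>x. \<exists>r>0. \<exists>c :: ('p \<Rightarrow> nat) \<Rightarrow> real. \<forall>y. norm (y - x) < r \<longrightarrow>
        ((\<lambda>\<alpha>. c \<alpha> * (\<Prod>i\<in>UNIV. vec_nth (y - x) i ^ \<alpha> i)) has_sum f y) UNIV)"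

definition param_mat ::
    "nat \<Rightarrow> nat \<Rightarrow> (nat \<Rightarrow> real ^ 'p \<Rightarrow> real) \<Rightarrow> (nat \<Rightarrow> cmat) \<Rightarrow> real ^ 'p \<Rightarrow> cmat" where
  "param_mat n \<kappa> \<theta> Am \<mu> =
     Matrix.mat n n (\<lambda>(a, b). \<Sum>m=1..\<kappa>. of_real (\<theta> m \<mu>) * index_mat (Am m) (a, b))"

text \<open>The \<open>min (dim_row M) (dim_col M)\<close> singular values of \<open>M\<close> with multiplicity, in ascending
  order: square roots of the eigenvalues of the smaller of the two Gram matrices.  These
  eigenvalues are real and nonnegative, so \<open>Re\<close> only changes the type.\<close>

definition singular_values :: "cmat \<Rightarrow> real list" where
  "singular_values M =
     sorted_list_of_multiset (image_mset (\<lambda>z. sqrt (Re z)) (proots (char_poly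
       (if dim_col M \<le> dim_row M then mat_adjoint M * M else M * mat_adjoint M))))"

text \<open>The \<open>k\<close>-th smallest singular value, with \<open>k\<close> counted from 1.\<close>

definition sv :: "nat \<Rightarrow> cmat \<Rightarrow> real" where
  "sv k M = singular_values M ! (k - 1)"

definition sv_min :: "cmat \<Rightarrow> real" where
  "sv_min M = sv 1 M"

definition simple_sv :: "cmat \<Rightarrow> real \<Rightarrow> bool" where
  "simple_sv M s \<longleftrightarrow> count_list (singular_values M) s = 1"

text \<open>The second equation is the adjoint of \<open>u\<^sup>* M = s v\<^sup>*\<close> (\<open>s\<close> being real).\<close>

definition sv_pair :: "cmat \<Rightarrow> real \<Rightarrow> cvec \<Rightarrow> cvec \<Rightarrow> bool" where
  "sv_pair M s u v \<longleftrightarrow>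
     u \<in> carrier_vec (dim_row M) \<and> v \<in> carrier_vec (dim_col M) \<and>
     u \<bullet>c u = 1 \<and> v \<bullet>c v = 1 \<and>
     M *\<^sub>v v = of_real s \<cdot>\<^sub>v u \<and> mat_adjoint M *\<^sub>v u = of_real s \<cdot>\<^sub>v v"

definition right_sv :: "cmat \<Rightarrow> real \<Rightarrow> cvec \<Rightarrow> bool" where
  "right_sv M s v \<longleftrightarrow> (\<exists>u. sv_pair M s u v)"

definition orthonormal_family :: "nat \<Rightarrow> (nat \<Rightarrow> cvec) \<Rightarrow> bool" where
  "orthonormal_family l x \<longleftrightarrow>
     (\<forall>i\<in>{1..l}. \<forall>k\<in>{1..l}. x i \<bullet>c x k = (if i = k then 1 else 0))"

abbreviation cspan :: "nat \<Rightarrow> cvec set \<Rightarrow> cvec set" where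
  "cspan n \<equiv> LinearCombinations.module.span class_ring (module_vec TYPE(complex) n)"

definition subspace_plus :: "cvec set \<Rightarrow> cvec set \<Rightarrow> cvec set" where
  "subspace_plus S T = {x + y | x y. x \<in> S \<and> y \<in> T}"

definition onb_mat :: "nat \<Rightarrow> cvec set \<Rightarrow> cmat \<Rightarrow> bool" where
  "onb_mat n S V \<longleftrightarrow>
     dim_row V = n \<and> mat_adjoint V * V = 1\<^sub>m (dim_col V) \<and> cspan n (set (cols V)) = S"

text \<open>\<open>\<sigma>\<^bsup>V,U\<^esup>\<close> for the matrix \<open>A\<close> at one parameter, \<open>w\<close> being the chosen right singular vector of
  \<open>A V\<close>.  Since \<open>x \<bullet>c y\<close> is \<open>y\<^sup>* x\<close>, the radicand is \<open>w\<^sup>* V\<^sup>* A\<^sup>* U U\<^sup>* A V w\<close>, a nonnegative real.\<close>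

definition sigma_VU :: "cmat \<Rightarrow> cmat \<Rightarrow> cmat \<Rightarrow> cvec \<Rightarrow> real" where
  "sigma_VU A V U w =
     sqrt (Re ((mat_adjoint V *\<^sub>v (mat_adjoint A *\<^sub>v (U *\<^sub>v (mat_adjoint U *\<^sub>v
       (A *\<^sub>v (V *\<^sub>v w)))))) \<bullet>c w))"

text \<open>A run of the two-sided greedy procedure, for the matrix family \<open>A\<close>, singular vectors
  \<open>u k \<mu>\<close>, \<open>v k \<mu>\<close>, subspaces \<open>SV j\<close>, \<open>SU j\<close>, orthonormal basis matrices \<open>V j\<close>, \<open>U j\<close> of these and
  selected right singular vectors \<open>w j \<mu>\<close> of \<open>A \<mu> * V j\<close>.  Everything is indexed from 1; the
  selections \<open>w\<close> are arbitrary, in particular not assumed to be continuous in \<open>\<mu>\<close>.\<close>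

definition two_sided_greedy ::
    "nat \<Rightarrow> nat \<Rightarrow> (real ^ 'p) set \<Rightarrow> (real ^ 'p \<Rightarrow> cmat) \<Rightarrow>
     (nat \<Rightarrow> real ^ 'p \<Rightarrow> cvec) \<Rightarrow> (nat \<Rightarrow> real ^ 'p \<Rightarrow> cvec) \<Rightarrow>
     (nat \<Rightarrow> real ^ 'p) \<Rightarrow> (nat \<Rightarrow> cvec set) \<Rightarrow> (nat \<Rightarrow> cvec set) \<Rightarrow>
     (nat \<Rightarrow> cmat) \<Rightarrow> (nat \<Rightarrow> cmat) \<Rightarrow> (nat \<Rightarrow> real ^ 'p \<Rightarrow> cvec) \<Rightarrow> bool" where
  "two_sided_greedy n l D A u v \<mu> SV SU V U w \<longleftrightarrow>
     \<mu> 1 \<in> D \<and>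
     SV 1 = cspan n ((\<lambda>k. v k (\<mu> 1)) ` {1..l}) \<and>
     SU 1 = cspan n ((\<lambda>k. u k (\<mu> 1)) ` {1..l}) \<and>
     (\<forall>j\<ge>1. onb_mat n (SV j) (V j) \<and> onb_mat n (SU j) (U j)) \<and>
     (\<forall>j\<ge>1. \<forall>x. right_sv (A x * V j) (sv_min (A x * V j)) (w j x)) \<and>
     (\<forall>j\<ge>1.
        is_arg_max (\<lambda>x. sv_min (A x * V j) - sigma_VU (A x) (V j) (U j) (w j x)) (\<lambda>x. x \<in> D)
          (\<mu> (j + 1)) \<and>
        SV (j + 1) = subspace_plus (SV j) (cspan n ((\<lambda>k. v k (\<mu> (j + 1))) ` {1..l})) \<and>
        SU (j + 1) = subspace_plus (SU j) (cspan n ((\<lambda>k. u k (\<mu> (j + 1))) ` {1..l})))"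

end

theory Submission
  imports Defs
begin

text \<open>
  Write \<open>x\<^sub>0 = \<mu>\<^sub>i\<close>, \<open>s\<close> for the smallest singular value of \<open>A(x\<^sub>0)\<close>, and \<open>u\<close>, \<open>v\<close> for its singular vectors;
  these lie in \<open>\<U>\<^sub>j\<close> and \<open>\<V>\<^sub>j\<close>.  Since \<open>v \<in> \<V>\<^sub>j\<close>, for all \<open>x\<close>
  the smallest singular values of \<open>A(x)\<close> and \<open>A(x) V\<close> and the value \<open>\<sigma>\<^bsup>V,U\<^esup>(x)\<close> are at most
  \<open>\<bar>A(x) v\<bar>\<close>.  On the other hand each of them is at least \<open>\<bar>u\<^sup>* A(x) y\<bar>\<close> for some unit vector \<open>y\<close> with
  \<open>\<bar>A(x) y\<bar> \<le> \<bar>A(x) v\<bar>\<close>.  If \<open>s\<close> is simple, the spectral gap forces such a \<open>y\<close> to have a component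
  of size \<open>O(\<bar>A(x) - A(x\<^sub>0)\<bar>)\<close> orthogonal to \<open>v\<close>, so \<open>\<bar>u\<^sup>* A(x) y\<bar>\<close> is at least
  \<open>Re (u\<^sup>* A(x) v) - C \<bar>A(x) - A(x\<^sub>0)\<bar>\<^sup>2\<close>.  Both bounds equal \<open>s\<close> at \<open>x\<^sub>0\<close> and, when \<open>s \<noteq> 0\<close>, are
  differentiable there, so every function between them has the same gradient at \<open>x\<^sub>0\<close>.
\<close>

no_notation vec_nth (infixl "$" 90)
no_notation inner (infix "\<bullet>" 70)

subsection \<open>Inner product and norm on complex vectors\<close>

text \<open>The Euclidean norm. Since \<open>x \<bullet>c x\<close> is a nonnegative real,
  \<open>Re\<close> only changes the type.\<close>

definition vnorm :: "cvec \<Rightarrow> real" where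
  "vnorm x = sqrt (Re (x \<bullet>c x))"

lemma cip_sum: "x \<bullet>c y = (\<Sum>i<dim_vec y. x $ i * cnj (y $ i))"
  by (simp add: scalar_prod_def atLeast0LessThan)

lemma vnorm_sq_sum: "(vnorm x)\<^sup>2 = (\<Sum>i<dim_vec x. (cmod (x $ i))\<^sup>2)"
  by (simp add: vnorm_def cip_sum complex_norm_square[symmetric] sum_nonneg flip: of_real_power)

text \<open>Passes to the moduli of the entries, where the real Cauchy-Schwarz inequality for
  \<open>L2_set\<close> applies.\<close>

lemma vnorm_L2: "vnorm x = L2_set (\<lambda>i. cmod (x $ i)) {..<dim_vec x}"
  using conjugate_square_ge_0_vec[of x]
  by (simp add: L2_set_def vnorm_sq_sum[symmetric] vnorm_def less_eq_complex_def)

lemma vnorm_nonneg [simp]: "0 \<le> vnorm x"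
  by (simp add: vnorm_L2)

lemma cip_self: "x \<bullet>c x = of_real ((vnorm x)\<^sup>2)"
  unfolding vnorm_sq_sum cip_sum of_real_sum
  by (simp only: complex_norm_square)

lemma cip_add_left:
  "x \<in> carrier_vec n \<Longrightarrow> y \<in> carrier_vec n \<Longrightarrow> z \<in> carrier_vec n \<Longrightarrow>
     (x + y :: cvec) \<bullet>c z = x \<bullet>c z + y \<bullet>c z"
  by (simp add: cip_sum distrib_right sum.distrib)

lemma cip_add_right:
  "x \<in> carrier_vec n \<Longrightarrow> y \<in> carrier_vec n \<Longrightarrow> z \<in> carrier_vec n \<Longrightarrow>
     (z :: cvec) \<bullet>c (x + y) = z \<bullet>c x + z \<bullet>c y"
  by (simp add: cip_sum distrib_left sum.distrib)

lemma cip_smult_left: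
  "x \<in> carrier_vec n \<Longrightarrow> z \<in> carrier_vec n \<Longrightarrow> (c \<cdot>\<^sub>v x :: cvec) \<bullet>c z = c * (x \<bullet>c z)"
  by (simp add: cip_sum sum_distrib_left mult.assoc)

lemma cip_smult_right:
  "x \<in> carrier_vec n \<Longrightarrow> z \<in> carrier_vec n \<Longrightarrow> (z :: cvec) \<bullet>c (c \<cdot>\<^sub>v x) = cnj c * (z \<bullet>c x)"
  by (simp add: cip_sum sum_distrib_left algebra_simps)

lemma cip_swap:
  "x \<in> carrier_vec n \<Longrightarrow> y \<in> carrier_vec n \<Longrightarrow> (y :: cvec) \<bullet>c x = cnj (x \<bullet>c y)"
  by (simp add: cip_sum mult.commute)

lemma vnorm_smult: "vnorm (c \<cdot>\<^sub>v x) = cmod c * vnorm x"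
proof -
  have "(vnorm (c \<cdot>\<^sub>v x))\<^sup>2 = (cmod c * vnorm x)\<^sup>2"
    by (simp add: vnorm_sq_sum norm_mult power_mult_distrib sum_distrib_left)
  then show ?thesis by (simp add: power2_eq_iff_nonneg)
qed

lemma cip_Cauchy_Schwarz:
  assumes "x \<in> carrier_vec n" "y \<in> carrier_vec n"
  shows "cmod (x \<bullet>c y) \<le> vnorm x * vnorm y"
proof -
  have "cmod (x \<bullet>c y) \<le> (\<Sum>i<n. cmod (x $ i) * cmod (y $ i))"
    using assms unfolding cip_sum by (auto intro!: sum_norm_le simp: norm_mult)
  also have "\<dots> \<le> L2_set (\<lambda>i. cmod (x $ i)) {..<n} * L2_set (\<lambda>i. cmod (y $ i)) {..<n}"
    using L2_set_mult_ineq[of "\<lambda>i. cmod (x $ i)" "\<lambda>i. cmod (y $ i)" "{..<n}"] by simp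
  finally show ?thesis using assms by (simp add: vnorm_L2)
qed

lemma vnorm_add_sq:
  assumes "x \<in> carrier_vec n" "y \<in> carrier_vec n"
  shows "(vnorm (x + y))\<^sup>2 = (vnorm x)\<^sup>2 + 2 * Re (x \<bullet>c y) + (vnorm y)\<^sup>2"
proof -
  have "(x + y) \<bullet>c (x + y) = x \<bullet>c x + x \<bullet>c y + cnj (x \<bullet>c y) + y \<bullet>c y"
    using assms cip_swap[OF assms] by (simp add: cip_add_left[of _ n] cip_add_right[of _ n])
  from arg_cong[OF this, of Re] show ?thesis
    by (simp add: cip_self del: of_real_power)
qed

lemma vnorm_triangle:
  assumes "x \<in> carrier_vec n" "y \<in> carrier_vec n"
  shows "vnorm (x + y) \<le> vnorm x + vnorm y"
proof (rule power2_le_imp_le)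
  have "Re (x \<bullet>c y) \<le> vnorm x * vnorm y"
    using complex_Re_le_cmod cip_Cauchy_Schwarz[OF assms] by (rule order_trans)
  then show "(vnorm (x + y))\<^sup>2 \<le> (vnorm x + vnorm y)\<^sup>2"
    unfolding vnorm_add_sq[OF assms] by (simp add: power2_sum)
qed simp

lemma vnorm_eq_0: "x \<in> carrier_vec n \<Longrightarrow> vnorm x = 0 \<longleftrightarrow> x = 0\<^sub>v n"
  using conjugate_square_eq_0_vec[of x n] by (simp add: cip_self)

subsection \<open>Adjoints and isometries\<close>

lemma adjoint_carrier [simp]: "M \<in> carrier_mat r c \<Longrightarrow> mat_adjoint M \<in> carrier_mat c r"
  by (auto simp: mat_adjoint_def)

lemma adjoint_dim [simp]: "dim_row (mat_adjoint M) = dim_col M" "dim_col (mat_adjoint M) = dim_row M"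
  by (auto simp: mat_adjoint_def)

lemma adjoint_index [simp]:
  "i < dim_col M \<Longrightarrow> j < dim_row M \<Longrightarrow> (mat_adjoint M :: cmat) $$ (i, j) = cnj (M $$ (j, i))"
  by (simp add: mat_adjoint_def mat_of_rows_def)

lemma adjoint_adjoint [simp]: "mat_adjoint (mat_adjoint M) = (M :: cmat)"
  by (rule eq_matI) auto

lemma adjoint_mult:
  "A \<in> carrier_mat n m \<Longrightarrow> B \<in> carrier_mat m k \<Longrightarrow>
     mat_adjoint (A * B) = mat_adjoint B * (mat_adjoint A :: cmat)"
  by (rule eq_matI) (auto simp: scalar_prod_def mult.commute)

lemma cip_adjoint:
  assumes "(M :: cmat) \<in> carrier_mat r c" "x \<in> carrier_vec c" "y \<in> carrier_vec r"
  shows "(M *\<^sub>v x) \<bullet>c y = x \<bullet>c (mat_adjoint M *\<^sub>v y)"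
proof -
  have "(M *\<^sub>v x) \<bullet>c y = (\<Sum>i<r. \<Sum>k<c. M $$ (i,k) * x $ k * cnj (y $ i))"
    using assms by (simp add: cip_sum scalar_prod_def sum_distrib_right atLeast0LessThan)
  also have "\<dots> = (\<Sum>k<c. \<Sum>i<r. M $$ (i,k) * x $ k * cnj (y $ i))"
    by (rule sum.swap)
  also have "\<dots> = x \<bullet>c (mat_adjoint M *\<^sub>v y)"
    using assms
    by (simp add: cip_sum scalar_prod_def sum_distrib_left atLeast0LessThan algebra_simps)
  finally show ?thesis .
qed

lemma isometry_cip:
  assumes "(M :: cmat) \<in> carrier_mat r c" "mat_adjoint M * M = 1\<^sub>m c"
    and "x \<in> carrier_vec c" "y \<in> carrier_vec c"
  shows "(M *\<^sub>v x) \<bullet>c (M *\<^sub>v y) = x \<bullet>c y"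
proof -
  have "(M *\<^sub>v x) \<bullet>c (M *\<^sub>v y) = x \<bullet>c (mat_adjoint M *\<^sub>v (M *\<^sub>v y))"
    using assms by (intro cip_adjoint[of _ r c]) auto
  also have "mat_adjoint M *\<^sub>v (M *\<^sub>v y) = (mat_adjoint M * M) *\<^sub>v y"
    using assms by (intro assoc_mult_mat_vec[symmetric]) auto
  finally show ?thesis using assms by simp
qed

lemma isometry_vnorm:
  assumes "(M :: cmat) \<in> carrier_mat r c" "mat_adjoint M * M = 1\<^sub>m c" "x \<in> carrier_vec c"
  shows "vnorm (M *\<^sub>v x) = vnorm x"
  using isometry_cip[OF assms(1-3,3)] by (simp add: vnorm_def)

text \<open>The Frobenius norm. It dominates the operator norm, while its square is a sum of squares
  of real and imaginary parts of entries, hence differentiable whenever the entries are.\<close>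

definition frob :: "cmat \<Rightarrow> real" where
  "frob M = sqrt (\<Sum>a<dim_row M. \<Sum>b<dim_col M. (cmod (M $$ (a, b)))\<^sup>2)"

lemma frob_nonneg [simp]: "0 \<le> frob M"
  by (simp add: frob_def sum_nonneg)

text \<open>Cauchy-Schwarz in each row, summed over the rows.\<close>

lemma vnorm_mult_le_frob:
  assumes "M \<in> carrier_mat r c" "x \<in> carrier_vec c"
  shows "vnorm (M *\<^sub>v x) \<le> frob M * vnorm x"
proof (rule power2_le_imp_le)
  have *: "(cmod ((M *\<^sub>v x) $ a))\<^sup>2 \<le> (\<Sum>b<c. (cmod (M $$ (a, b)))\<^sup>2) * (vnorm x)\<^sup>2" if "a < r" for a
  proof -
    \<comment> \<open>The product of a row with \<open>x\<close> carries no conjugation; conjugating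
      \<open>x\<close> undoes the one in \<open>\<bullet>c\<close>.\<close>
    have "(M *\<^sub>v x) $ a = row M a \<bullet>c conjugate x"
      using that assms by simp
    then have "cmod ((M *\<^sub>v x) $ a) \<le> vnorm (row M a) * vnorm (conjugate x)"
      using that assms cip_Cauchy_Schwarz[of "row M a" c "conjugate x"] by auto
    then have "(cmod ((M *\<^sub>v x) $ a))\<^sup>2 \<le> (vnorm (row M a) * vnorm (conjugate x))\<^sup>2"
      by (rule power_mono) simp
    also have "\<dots> = (\<Sum>b<c. (cmod (M $$ (a, b)))\<^sup>2) * (vnorm x)\<^sup>2"
      unfolding power_mult_distrib vnorm_sq_sum using that assms by simp
    finally show ?thesis .
  qed
  have "(vnorm (M *\<^sub>v x))\<^sup>2 \<le> (\<Sum>a<r. (\<Sum>b<c. (cmod (M $$ (a, b)))\<^sup>2) * (vnorm x)\<^sup>2)"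
    unfolding vnorm_sq_sum[of "M *\<^sub>v x"] using assms * by (auto intro!: sum_mono)
  also have "\<dots> = (frob M * vnorm x)\<^sup>2"
    using assms by (simp add: frob_def power_mult_distrib sum_nonneg sum_distrib_right)
  finally show "(vnorm (M *\<^sub>v x))\<^sup>2 \<le> (frob M * vnorm x)\<^sup>2" .
qed simp

subsection \<open>Unitary diagonalisation of Hermitian matrices\<close>

text \<open>Complete \<open>v\<close> to a basis, orthogonalise by Gram-Schmidt, which keeps the
  first vector, and divide each vector by its norm. The scalar \<open>c\<close> appears because
  \<open>v\<close> need not be a unit vector.\<close>

lemma unitary_with_first_column:
  fixes v :: cvec
  assumes v: "v \<in> carrier_vec n" and v0: "v \<noteq> 0\<^sub>v n" and n: "n \<noteq> 0"
  obtains W c where "W \<in> carrier_mat n n" "mat_adjoint W * W = 1\<^sub>m n" "col W 0 = c \<cdot>\<^sub>v v"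
proof -
  interpret cof_vec_space n "TYPE(complex)" .
  define ws where "ws = gram_schmidt n (basis_completion v)"
  note b = basis_completion[OF v v0]
  obtain vs where bv: "basis_completion v = v # vs"
    using b(6,7) n by (cases "basis_completion v") auto
  have ws: "set ws \<subseteq> carrier_vec n" "corthogonal ws" "length ws = n"
    using gram_schmidt_result[OF b(2) b(4) b(5) refl] b(6) by (auto simp: ws_def)
  have hd: "ws ! 0 = v"
    using gram_schmidt_hd[OF v, of vs] ws(3) n by (cases ws) (auto simp: ws_def bv)
  have wsc: "ws ! i \<in> carrier_vec n" if "i < n" for i
    using ws that by auto
  define W where
    "W = mat_of_cols n (map (\<lambda>x. of_real (1 / vnorm x) \<cdot>\<^sub>v x) ws)"
  have W: "W \<in> carrier_mat n n"
    using ws(3) by (auto simp: W_def)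
  have col: "col W i = of_real (1 / vnorm (ws ! i)) \<cdot>\<^sub>v ws ! i" if "i < n" for i
    using that ws(3) wsc[OF that] unfolding W_def by (subst col_mat_of_cols) auto
  have nz: "vnorm (ws ! i) \<noteq> 0" if "i < n" for i
    using corthogonalD[OF ws(2), of i i] that ws(3) by (simp add: cip_self)
  have "mat_adjoint W * W = 1\<^sub>m n"
  proof (rule eq_matI)
    fix i j assume "i < dim_row (1\<^sub>m n :: cmat)" "j < dim_col (1\<^sub>m n :: cmat)"
    then have ij: "i < n" "j < n" by auto
    have "(mat_adjoint W * W) $$ (i, j) = col W j \<bullet>c col W i"
      using ij W by (auto simp: cip_sum scalar_prod_def atLeast0LessThan intro!: sum.cong)
    also have "\<dots> = of_real (1 / vnorm (ws ! j)) * (of_real (1 / vnorm (ws ! i)) * (ws ! j \<bullet>c ws ! i))"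
      unfolding col[OF ij(1)] col[OF ij(2)]
      using wsc[OF ij(1)] wsc[OF ij(2)]
      by (subst cip_smult_left[of _ n], simp, simp, subst cip_smult_right[of _ n], simp, simp, simp)
    also have "\<dots> = 1\<^sub>m n $$ (i, j)"
    proof (cases "i = j")
      case True
      then show ?thesis
        using nz[OF ij(1)] ij by (simp add: cip_self power2_eq_square)
    next
      case False
      then show ?thesis
        using corthogonalD[OF ws(2), of j i] ws(3) ij by simp
    qed
    finally show "(mat_adjoint W * W) $$ (i, j) = 1\<^sub>m n $$ (i, j)" .
  qed (use W in auto)
  then show ?thesis
    using that[OF W] col[of 0] n hd by auto
qed

section \<open>Block diagonal matrices and unitary deflation\<close>

lemma adjoint_four_block_diag:
  assumes "A \<in> carrier_mat k k" "B \<in> carrier_mat m m"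
  shows "mat_adjoint (four_block_mat A (0\<^sub>m k m) (0\<^sub>m m k) B)
           = four_block_mat (mat_adjoint A) (0\<^sub>m k m) (0\<^sub>m m k) (mat_adjoint B :: cmat)"
  using assms by (intro eq_matI) auto

lemma mult_four_block_diag:
  assumes "A \<in> carrier_mat k k" "B \<in> carrier_mat m m" "C \<in> carrier_mat k k" "D \<in> carrier_mat m m"
  shows "four_block_mat A (0\<^sub>m k m) (0\<^sub>m m k) B * four_block_mat C (0\<^sub>m k m) (0\<^sub>m m k) D
           = four_block_mat (A * C) (0\<^sub>m k m) (0\<^sub>m m k) (B * D :: cmat)"
proof -
  have z: "0\<^sub>m k m \<in> carrier_mat k m" "0\<^sub>m m k \<in> carrier_mat m k" by auto
  show ?thesis
    unfolding mult_four_block_mat[OF assms(1) z assms(2,3) z assms(4)]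
    using assms by (simp add: mult_carrier_mat[of _ k k _ k] mult_carrier_mat[of _ m m _ m])
qed

lemma unitary_right_inverse:
  assumes "P \<in> carrier_mat n n" "mat_adjoint P * P = 1\<^sub>m n"
  shows "P * mat_adjoint P = (1\<^sub>m n :: cmat)"
  using mat_mult_left_right_inverse[of "mat_adjoint P" n P] assms by simp

text \<open>In an orthonormal basis that starts with an eigenvector for \<open>e\<close>, the first
  column of the matrix is \<open>e\<close> times the first unit vector; Hermitian symmetry then
  clears the first row as well.\<close>

lemma hermitian_deflation:
  fixes H :: cmat
  assumes H: "H \<in> carrier_mat (Suc m) (Suc m)" and adj: "mat_adjoint H = H"
  obtains W K e where "W \<in> carrier_mat (Suc m) (Suc m)" "mat_adjoint W * W = 1\<^sub>m (Suc m)"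
    "K \<in> carrier_mat m m" "mat_adjoint K = K"
    "mat_adjoint W * H * W = four_block_mat (Matrix.mat 1 1 (\<lambda>_. e)) (0\<^sub>m 1 m) (0\<^sub>m m 1) K"
proof -
  let ?n = "Suc m"
  \<comment> \<open>The characteristic polynomial splits over the complex numbers into
    \<open>Suc m\<close> linear factors, so there is an eigenvalue.\<close>
  obtain as where as: "char_poly H = (\<Prod>a\<leftarrow>as. [:- a, 1:])" "length as = ?n"
    using char_poly_factorized[OF H] by auto
  then obtain e where "e \<in> set as" by (cases as) auto
  then have "poly (char_poly H) e = 0"
    using as by (auto simp: poly_prod_list prod_list_zero_iff o_def)
  then obtain v where v: "v \<in> carrier_vec ?n" "v \<noteq> 0\<^sub>v ?n" and ev: "H *\<^sub>v v = e \<cdot>\<^sub>v v"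
    using eigenvalue_root_char_poly[OF H] H unfolding eigenvalue_def eigenvector_def by auto
  obtain W c where W: "W \<in> carrier_mat ?n ?n" "mat_adjoint W * W = 1\<^sub>m ?n"
    and col: "col W 0 = c \<cdot>\<^sub>v v"
    using unitary_with_first_column[OF v] by blast
  define G where "G = mat_adjoint W * H * W"
  have G: "G \<in> carrier_mat ?n ?n" using W H by (auto simp: G_def)
  have G_adj: "mat_adjoint G = G"
  proof -
    have "mat_adjoint G = mat_adjoint W * mat_adjoint (mat_adjoint W * H)"
      unfolding G_def using W H by (intro adjoint_mult[of _ ?n ?n _ ?n]) auto
    also have "mat_adjoint (mat_adjoint W * H) = H * W"
      using W H adj by (subst adjoint_mult[of _ ?n ?n _ ?n]) auto
    finally show ?thesis
      unfolding G_def using W H by (simp add: assoc_mult_mat[of _ ?n ?n _ ?n _ ?n])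
  qed
  have HW0: "H *\<^sub>v col W 0 = e \<cdot>\<^sub>v col W 0"
    unfolding col using mult_mat_vec[OF H v(1)] ev by (simp add: smult_smult_assoc mult.commute)
  \<comment> \<open>The first column of \<open>H * W\<close> is \<open>e\<close> times that of
    \<open>W\<close>, so unitarity of \<open>W\<close> yields the first column of
    \<open>G\<close>.\<close>
  have G0: "G $$ (i, 0) = (if i = 0 then e else 0)" if "i < ?n" for i
  proof -
    have "G $$ (i, 0) = (mat_adjoint W * (H * W)) $$ (i, 0)"
      using W H by (simp add: G_def assoc_mult_mat[of _ ?n ?n _ ?n _ ?n])
    also have "\<dots> = row (mat_adjoint W) i \<bullet> (H *\<^sub>v col W 0)"
      using that W H by (simp add: col_mult2[of _ ?n ?n _ ?n] mult_mat_vec_def)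
    also have "\<dots> = e * (row (mat_adjoint W) i \<bullet> col W 0)"
      unfolding HW0 using that W(1) col_dim[of W 0] by (intro scalar_prod_smult_distrib[of _ ?n]) auto
    also have "row (mat_adjoint W) i \<bullet> col W 0 = (mat_adjoint W * W) $$ (i, 0)"
      using that W(1) by (subst index_mult_mat) auto
    finally show ?thesis using that W by auto
  qed
  have G0': "G $$ (0, i) = (if i = 0 then cnj e else 0)" if "i < ?n" for i
    using G0[OF that] that G arg_cong[OF G_adj, of "\<lambda>X. X $$ (0, i)"] by (auto split: if_splits)
  define K where "K = Matrix.mat m m (\<lambda>(i, j). G $$ (Suc i, Suc j))"
  have "mat_adjoint K = K"
  proof (rule eq_matI)
    fix i j assume "i < dim_row K" "j < dim_col K"
    then show "mat_adjoint K $$ (i, j) = K $$ (i, j)"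
      using G arg_cong[OF G_adj, of "\<lambda>X. X $$ (Suc i, Suc j)"] by (auto simp: K_def)
  qed (auto simp: K_def)
  moreover have "G = four_block_mat (Matrix.mat 1 1 (\<lambda>_. e)) (0\<^sub>m 1 m) (0\<^sub>m m 1) K"
  proof (rule eq_matI)
    fix i j
    assume "i < dim_row (four_block_mat (Matrix.mat 1 1 (\<lambda>_. e)) (0\<^sub>m 1 m) (0\<^sub>m m 1) K)"
      and "j < dim_col (four_block_mat (Matrix.mat 1 1 (\<lambda>_. e)) (0\<^sub>m 1 m) (0\<^sub>m m 1) K)"
    then have "i < ?n" "j < ?n" by (auto simp: K_def)
    then show "G $$ (i, j) =
        four_block_mat (Matrix.mat 1 1 (\<lambda>_. e)) (0\<^sub>m 1 m) (0\<^sub>m m 1) K $$ (i, j)"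
      using G0[of i] G0'[of j] by (cases i; cases j) (auto simp: K_def)
  qed (use G in \<open>auto simp: K_def\<close>)
  moreover have "K \<in> carrier_mat m m" by (simp add: K_def)
  ultimately show ?thesis
    using that W unfolding G_def by blast
qed

text \<open>Induction on the size: deflate, diagonalise the remaining block \<open>K\<close>, and
  extend its unitary matrix by a 1 in the corner. The entries of \<open>d\<close> are left complex;
  for a Gram matrix they are later recognised as squared norms.\<close>

lemma hermitian_unitary_diagonalisation:
  fixes H :: cmat
  assumes "H \<in> carrier_mat n n" "mat_adjoint H = H"
  obtains P d where "P \<in> carrier_mat n n" "mat_adjoint P * P = 1\<^sub>m n"
    "mat_adjoint P * H * P = mat_diag n d"
proof -
  have "\<exists>P d. P \<in> carrier_mat n n \<and> mat_adjoint P * P = 1\<^sub>m n \<and>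
      mat_adjoint P * H * P = mat_diag n d"
    using assms
  proof (induction n arbitrary: H)
    case 0
    show ?case
      by (intro exI[of _ "1\<^sub>m 0"] exI[of _ "\<lambda>_. 0"]) (auto simp: mat_diag_def intro!: eq_matI)
  next
    case (Suc m)
    let ?n = "Suc m"
    obtain W K e where W: "W \<in> carrier_mat ?n ?n" "mat_adjoint W * W = 1\<^sub>m ?n"
      and K: "K \<in> carrier_mat m m" "mat_adjoint K = K"
      and WHW: "mat_adjoint W * H * W = four_block_mat (Matrix.mat 1 1 (\<lambda>_. e)) (0\<^sub>m 1 m) (0\<^sub>m m 1) K"
      using hermitian_deflation[OF Suc.prems] by blast
    from Suc.IH[OF K] obtain P d where P: "P \<in> carrier_mat m m" "mat_adjoint P * P = 1\<^sub>m m"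
      "mat_adjoint P * K * P = mat_diag m d" by blast
    define Q where "Q = four_block_mat (1\<^sub>m 1) (0\<^sub>m 1 m) (0\<^sub>m m 1) P"
    have Q: "Q \<in> carrier_mat ?n ?n" using P by (auto simp: Q_def)
    have one: "mat_adjoint (1\<^sub>m 1) = (1\<^sub>m 1 :: cmat)" by (rule eq_matI) auto
    have Qa: "mat_adjoint Q = four_block_mat (1\<^sub>m 1) (0\<^sub>m 1 m) (0\<^sub>m m 1) (mat_adjoint P)"
      unfolding Q_def by (subst adjoint_four_block_diag) (use P one in auto)
    have QQ: "mat_adjoint Q * Q = 1\<^sub>m ?n"
    proof -
      have "mat_adjoint Q * Q = four_block_mat (1\<^sub>m 1) (0\<^sub>m 1 m) (0\<^sub>m m 1) (1\<^sub>m m)"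
        unfolding Qa unfolding Q_def
        by (subst mult_four_block_diag[of _ 1 _ m]) (use P in auto)
      then show ?thesis by simp
    qed
    have WQ: "mat_adjoint (W * Q) = mat_adjoint Q * mat_adjoint W"
      using W Q by (intro adjoint_mult) auto
    have WQc: "W * Q \<in> carrier_mat ?n ?n" using W Q by auto
    have a: "mat_adjoint (W * Q) * (W * Q) = 1\<^sub>m ?n"
    proof -
      have "mat_adjoint (W * Q) * (W * Q) = mat_adjoint Q * ((mat_adjoint W * W) * Q)"
        unfolding WQ using W(1) Q by (simp add: assoc_mult_mat[of _ ?n ?n _ ?n _ ?n])
      also have "\<dots> = 1\<^sub>m ?n" using QQ Q by (simp add: W(2))
      finally show ?thesis .
    qed
    have "mat_adjoint (W * Q) * H * (W * Q) = mat_adjoint Q * (mat_adjoint W * H * W) * Q"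
      unfolding WQ using W(1) Q Suc.prems(1)
      by (simp add: assoc_mult_mat[of _ ?n ?n _ ?n _ ?n] mult_carrier_mat[of _ ?n ?n _ ?n])
    also have "\<dots> = four_block_mat (Matrix.mat 1 1 (\<lambda>_. e)) (0\<^sub>m 1 m) (0\<^sub>m m 1) (mat_diag m d)"
    proof -
      have "mat_adjoint Q * (mat_adjoint W * H * W)
          = four_block_mat (1\<^sub>m 1 * Matrix.mat 1 1 (\<lambda>_. e)) (0\<^sub>m 1 m) (0\<^sub>m m 1) (mat_adjoint P * K)"
        unfolding WHW Qa by (rule mult_four_block_diag) (use P K in auto)
      moreover have "\<dots> * Q = four_block_mat (1\<^sub>m 1 * Matrix.mat 1 1 (\<lambda>_. e) * 1\<^sub>m 1)
          (0\<^sub>m 1 m) (0\<^sub>m m 1) (mat_adjoint P * K * P)"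
        unfolding Q_def by (rule mult_four_block_diag) (use P K in auto)
      moreover have "1\<^sub>m 1 * Matrix.mat 1 1 (\<lambda>_. e) * 1\<^sub>m 1 = Matrix.mat 1 1 (\<lambda>_. e)"
        by (rule eq_matI) auto
      ultimately show ?thesis by (simp only: P(3))
    qed
    also have "\<dots> = mat_diag ?n (\<lambda>i. case i of 0 \<Rightarrow> e | Suc k \<Rightarrow> d k)"
      by (rule eq_matI) (auto simp: mat_diag_def split: nat.split)
    finally show ?case using a WQc by blast
  qed
  then show ?thesis using that by blast
qed

subsection \<open>The smallest singular value as a minimum\<close>

lemma mult_mat_vec_assoc3:
  assumes "A \<in> carrier_mat n m" "B \<in> carrier_mat m k" "C \<in> carrier_mat k l" "y \<in> carrier_vec l"
  shows "A * B * C *\<^sub>v y = A *\<^sub>v (B *\<^sub>v (C *\<^sub>v (y :: cvec)))"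
  using assms assoc_mult_mat_vec[of "A * B" n k C l y] assoc_mult_mat_vec[of A n m B k "C *\<^sub>v y"]
  by auto

text \<open>\<open>P\<close> diagonalises the Gram matrix \<open>mat_adjoint M * M\<close>, which is
  the one in \<open>singular_values M\<close> because \<open>c \<le> r\<close>. The last conclusion
  takes the place of left singular vectors: in the coordinates \<open>y\<close> the squared norm of
  the image is a weighted sum of squares.\<close>

lemma singular_value_decomposition:
  assumes M: "M \<in> carrier_mat r c" and cr: "c \<le> r"
  obtains P \<sigma> where "P \<in> carrier_mat c c" "mat_adjoint P * P = 1\<^sub>m c" "\<And>i. 0 \<le> \<sigma> i"
    "singular_values M = sort (map \<sigma> [0..<c])"
    "mat_adjoint P * (mat_adjoint M * M) * P = mat_diag c (\<lambda>i. of_real ((\<sigma> i)\<^sup>2))"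
    "\<And>y. y \<in> carrier_vec c \<Longrightarrow> (vnorm (M *\<^sub>v (P *\<^sub>v y)))\<^sup>2 = (\<Sum>i<c. (\<sigma> i)\<^sup>2 * (cmod (y $ i))\<^sup>2)"
proof -
  define H where "H = mat_adjoint M * M"
  have H: "H \<in> carrier_mat c c" using M by (auto simp: H_def)
  have adj: "mat_adjoint H = H"
    unfolding H_def using M by (subst adjoint_mult[of _ c r _ c]) auto
  obtain P d where P: "P \<in> carrier_mat c c" "mat_adjoint P * P = 1\<^sub>m c"
    and D: "mat_adjoint P * H * P = mat_diag c d"
    using hermitian_unitary_diagonalisation[OF H adj] by blast
  have PP: "P * mat_adjoint P = 1\<^sub>m c" using unitary_right_inverse P by blast
  have norm_eq: "of_real ((vnorm (M *\<^sub>v (P *\<^sub>v y)))\<^sup>2) = (\<Sum>i<c. d i * of_real ((cmod (y $ i))\<^sup>2))"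
    if y: "y \<in> carrier_vec c" for y
  proof -
    have Py: "P *\<^sub>v y \<in> carrier_vec c" using P y by auto
    have "of_real ((vnorm (M *\<^sub>v (P *\<^sub>v y)))\<^sup>2) = (M *\<^sub>v (P *\<^sub>v y)) \<bullet>c (M *\<^sub>v (P *\<^sub>v y))"
      by (simp add: cip_self)
    also have "\<dots> = (P *\<^sub>v y) \<bullet>c (H *\<^sub>v (P *\<^sub>v y))"
      using M Py assoc_mult_mat_vec[of "mat_adjoint M" c r M c "P *\<^sub>v y"]
      by (subst cip_adjoint[of _ r c]) (auto simp: H_def)
    also have "\<dots> = y \<bullet>c (mat_adjoint P *\<^sub>v (H *\<^sub>v (P *\<^sub>v y)))"
      using H P Py y by (intro cip_adjoint[of _ c c]) auto
    also have "mat_adjoint P *\<^sub>v (H *\<^sub>v (P *\<^sub>v y)) = mat_diag c d *\<^sub>v y"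
      unfolding D[symmetric] using H P y by (intro mult_mat_vec_assoc3[symmetric]) auto
    also have "y \<bullet>c (mat_diag c d *\<^sub>v y) = (\<Sum>i<c. cnj (d i) * of_real ((cmod (y $ i))\<^sup>2))"
    proof -
      have "(mat_diag c d *\<^sub>v y) $ i = d i * y $ i" if "i < c" for i
        using that y by (simp add: mat_diag_def scalar_prod_def if_distrib[of "\<lambda>t. t * _"] cong: if_cong)
      then show ?thesis
        unfolding cip_sum using y
        by (intro sum.cong) (auto simp: mat_diag_def complex_norm_square algebra_simps simp del: of_real_power)
    qed
    \<comment> \<open>\<open>\<bullet>c\<close> conjugates its second argument, which leaves
      \<open>cnj (d i)\<close>; the left side is real, so conjugating once more restores
      \<open>d i\<close>.\<close>
    finally have "cnj (of_real ((vnorm (M *\<^sub>v (P *\<^sub>v y)))\<^sup>2))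
        = cnj (\<Sum>i<c. cnj (d i) * of_real ((cmod (y $ i))\<^sup>2))" by simp
    then show ?thesis by simp
  qed
  \<comment> \<open>The norm of the image of the \<open>i\<close>-th column of \<open>P\<close> is
    nonnegative at once, and \<open>norm_eq\<close> at a unit vector shows that \<open>d i\<close>
    is its square.\<close>
  define \<sigma> where "\<sigma> i = vnorm (M *\<^sub>v (P *\<^sub>v unit_vec c i))" for i
  have d: "d i = of_real ((\<sigma> i)\<^sup>2)" if "i < c" for i
  proof -
    have "of_real ((\<sigma> i)\<^sup>2) = (\<Sum>k<c. d k * of_real ((cmod (unit_vec c i $ k))\<^sup>2))"
      unfolding \<sigma>_def by (rule norm_eq) simp
    also have "\<dots> = (\<Sum>k<c. if k = i then d i else 0)"
      using that by (intro sum.cong) auto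
    finally show ?thesis using that by simp
  qed
  have D': "mat_diag c d = mat_diag c (\<lambda>i. of_real ((\<sigma> i)\<^sup>2))"
    using d by (intro eq_matI) (auto simp: mat_diag_def)
  have HP: "H = P * mat_diag c d * mat_adjoint P"
  proof -
    have "P * mat_diag c d * mat_adjoint P = (P * mat_adjoint P) * H * (P * mat_adjoint P)"
      unfolding D[symmetric] using P(1) H by (simp add: assoc_mult_mat[of _ c c _ c _ c] mult_carrier_mat[of _ c c _ c])
    then show ?thesis using PP H by simp
  qed
  \<comment> \<open>Similar matrices share the characteristic polynomial, so the eigenvalues of
    \<open>H\<close> with multiplicity are the \<open>d i\<close>.\<close>
  have "similar_mat_wit H (mat_diag c d) P (mat_adjoint P)"
    by (rule similar_mat_witI[of _ _ c]) (use P PP H HP in auto)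
  then have "char_poly H = char_poly (mat_diag c d)"
    using char_poly_similar similar_mat_def by blast
  also have "\<dots> = (\<Prod>a\<leftarrow>diag_mat (mat_diag c d). [:- a, 1:])"
    by (rule char_poly_upper_triangular[of _ c]) (auto simp: mat_diag_def)
  also have "diag_mat (mat_diag c d) = map d [0..<c]"
    by (auto simp: diag_mat_def mat_diag_def intro!: nth_equalityI)
  finally have cp: "char_poly H = (\<Prod>a\<leftarrow>map d [0..<c]. [:- a, 1:])" .
  have roots: "proots (\<Prod>a\<leftarrow>as. [:- a, 1:]) = mset as" for as :: "complex list"
  proof (induction as)
    case (Cons a as)
    have "(\<Prod>a\<leftarrow>as. [:- a, 1:]) \<noteq> 0" by (auto simp: prod_list_zero_iff)
    then have "proots ([:- a, 1:] * (\<Prod>a\<leftarrow>as. [:- a, 1:])) = {#a#} + proots (\<Prod>a\<leftarrow>as. [:- a, 1:])"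
      by (subst proots_mult) auto
    then show ?case using Cons by (simp del: mult_pCons_left)
  qed simp
  have "sorted_list_of_multiset (image_mset (\<lambda>z. sqrt (Re z)) (mset (map d [0..<c])))
      = sort (map (\<lambda>i. sqrt (Re (d i))) [0..<c])"
    by (simp add: o_def flip: mset_map)
  also have "map (\<lambda>i. sqrt (Re (d i))) [0..<c] = map \<sigma> [0..<c]"
    by (auto simp: d \<sigma>_def)
  finally have "singular_values M = sort (map \<sigma> [0..<c])"
    unfolding roots[symmetric] cp[symmetric] using M cr by (simp add: singular_values_def H_def)
  moreover have "(vnorm (M *\<^sub>v (P *\<^sub>v y)))\<^sup>2 = (\<Sum>i<c. (\<sigma> i)\<^sup>2 * (cmod (y $ i))\<^sup>2)"
    if "y \<in> carrier_vec c" for y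
  proof -
    have "complex_of_real ((vnorm (M *\<^sub>v (P *\<^sub>v y)))\<^sup>2)
        = complex_of_real (\<Sum>i<c. (\<sigma> i)\<^sup>2 * (cmod (y $ i))\<^sup>2)"
      unfolding norm_eq[OF that] by (simp add: d)
    then show ?thesis by (simp only: of_real_eq_iff)
  qed
  moreover have "0 \<le> \<sigma> i" for i by (simp add: \<sigma>_def)
  ultimately show ?thesis
    using P D D' unfolding H_def by (intro that[of P \<sigma>]) simp_all
qed

lemma unitary_preimage:
  assumes "P \<in> carrier_mat c c" "mat_adjoint P * P = 1\<^sub>m c" "x \<in> carrier_vec c"
  shows "x = P *\<^sub>v (mat_adjoint P *\<^sub>v x :: cvec)"
  using unitary_right_inverse[OF assms(1,2)] assms(1,3)
    assoc_mult_mat_vec[of P c c "mat_adjoint P" c x] by simp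

lemma sort_nth_0:
  assumes "xs \<noteq> []"
  shows "sort xs ! 0 \<in> set xs" "x \<in> set xs \<Longrightarrow> sort xs ! 0 \<le> x"
proof -
  have len: "0 < length (sort xs)" using assms by simp
  then show "sort xs ! 0 \<in> set xs" using nth_mem[OF len] by simp
  assume "x \<in> set xs"
  then obtain k where "k < length (sort xs)" "sort xs ! k = x"
    by (metis in_set_conv_nth set_sort)
  then show "sort xs ! 0 \<le> x"
    using sorted_nth_mono[of "sort xs" 0 k] by auto
qed

text \<open>\<open>sv 1\<close> reads the entry with index 0 of an ascending list, which is nonempty
  by \<open>1 \<le> c\<close>.\<close>

lemma sv_min_is_minimum:
  assumes "singular_values M = sort (map \<sigma> [0..<c])" "1 \<le> c"
  shows "\<exists>i<c. \<sigma> i = sv_min M" "i < c \<Longrightarrow> sv_min M \<le> \<sigma> i"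
proof -
  have ne: "map \<sigma> [0..<c] \<noteq> []" using assms(2) by auto
  have eq: "sv_min M = sort (map \<sigma> [0..<c]) ! 0"
    by (simp add: sv_min_def sv_def assms(1))
  show "\<exists>i<c. \<sigma> i = sv_min M"
    using sort_nth_0(1)[OF ne] unfolding eq[symmetric] by auto
  show "sv_min M \<le> \<sigma> i" if "i < c"
    unfolding eq using that by (intro sort_nth_0(2)[OF ne]) auto
qed

text \<open>In the coordinates \<open>y\<close> every weight \<open>(\<sigma> i)\<^sup>2\<close> is
  at least \<open>(sv_min M)\<^sup>2\<close>. Together with \<open>sv_min_attained\<close> this
  makes \<open>sv_min M\<close> the minimum of \<open>\<bar>M x\<bar>\<close> over unit vectors, the
  form in which matrices of different widths can be compared.\<close>

lemma sv_min_mult_le: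
  assumes M: "M \<in> carrier_mat r c" and "c \<le> r" "1 \<le> c" and x: "x \<in> carrier_vec c"
  shows "sv_min M * vnorm x \<le> vnorm (M *\<^sub>v x)"
proof (rule power2_le_imp_le)
  obtain P \<sigma> where P: "P \<in> carrier_mat c c" "mat_adjoint P * P = 1\<^sub>m c" and pos: "\<And>i. 0 \<le> \<sigma> i"
    and sv: "singular_values M = sort (map \<sigma> [0..<c])"
    and D: "mat_adjoint P * (mat_adjoint M * M) * P = mat_diag c (\<lambda>i. of_real ((\<sigma> i)\<^sup>2))"
    and eq: "\<And>y. y \<in> carrier_vec c \<Longrightarrow> (vnorm (M *\<^sub>v (P *\<^sub>v y)))\<^sup>2 = (\<Sum>i<c. (\<sigma> i)\<^sup>2 * (cmod (y $ i))\<^sup>2)"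
    by (rule singular_value_decomposition[OF M \<open>c \<le> r\<close>]) (rule that)
  note min = sv_min_is_minimum[OF sv \<open>1 \<le> c\<close>]
  have nonneg: "0 \<le> sv_min M" using min(1) pos by metis
  define y where "y = mat_adjoint P *\<^sub>v x"
  have y: "y \<in> carrier_vec c" using P x by (auto simp: y_def intro!: mult_mat_vec_carrier[OF adjoint_carrier])
  have xy: "x = P *\<^sub>v y" unfolding y_def by (rule unitary_preimage[OF P x])
  have "(sv_min M * vnorm x)\<^sup>2 = (\<Sum>i<c. (sv_min M)\<^sup>2 * (cmod (y $ i))\<^sup>2)"
    unfolding xy isometry_vnorm[OF P y] power_mult_distrib vnorm_sq_sum
    using y by (simp add: sum_distrib_left)
  also have "\<dots> \<le> (\<Sum>i<c. (\<sigma> i)\<^sup>2 * (cmod (y $ i))\<^sup>2)"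
    using nonneg min(2) by (intro sum_mono mult_right_mono power_mono) auto
  also have "\<dots> = (vnorm (M *\<^sub>v x))\<^sup>2" by (simp add: eq[OF y] xy)
  finally show "(sv_min M * vnorm x)\<^sup>2 \<le> (vnorm (M *\<^sub>v x))\<^sup>2" .
qed simp

text \<open>The minimiser is a column of \<open>P\<close> that belongs to the smallest
  \<open>\<sigma> i\<close>.\<close>

lemma sv_min_attained:
  assumes M: "M \<in> carrier_mat r c" and "c \<le> r" "1 \<le> c"
  obtains x where "x \<in> carrier_vec c" "vnorm x = 1" "vnorm (M *\<^sub>v x) = sv_min M"
proof -
  obtain P \<sigma> where P: "P \<in> carrier_mat c c" "mat_adjoint P * P = 1\<^sub>m c" and pos: "\<And>i. 0 \<le> \<sigma> i"
    and sv: "singular_values M = sort (map \<sigma> [0..<c])"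
    and D: "mat_adjoint P * (mat_adjoint M * M) * P = mat_diag c (\<lambda>i. of_real ((\<sigma> i)\<^sup>2))"
    and eq: "\<And>y. y \<in> carrier_vec c \<Longrightarrow> (vnorm (M *\<^sub>v (P *\<^sub>v y)))\<^sup>2 = (\<Sum>i<c. (\<sigma> i)\<^sup>2 * (cmod (y $ i))\<^sup>2)"
    by (rule singular_value_decomposition[OF M \<open>c \<le> r\<close>]) (rule that)
  obtain i where i: "i < c" "\<sigma> i = sv_min M"
    using sv_min_is_minimum[OF sv \<open>1 \<le> c\<close>] by blast
  have u: "(\<Sum>k<c. f k * (cmod (unit_vec c i $ k))\<^sup>2) = (f i :: real)" for f
  proof -
    have "(\<Sum>k<c. f k * (cmod (unit_vec c i $ k))\<^sup>2) = (\<Sum>k<c. if k = i then f i else 0)"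
      using i by (intro sum.cong) auto
    then show ?thesis using i by simp
  qed
  show ?thesis
  proof
    show "P *\<^sub>v unit_vec c i \<in> carrier_vec c" using P by auto
    have "(vnorm (unit_vec c i))\<^sup>2 = 1" using u[of "\<lambda>_. 1"] by (simp add: vnorm_sq_sum)
    then have "vnorm (unit_vec c i) = 1"
      using power2_eq_iff_nonneg[of "vnorm (unit_vec c i)" 1] by simp
    then show "vnorm (P *\<^sub>v unit_vec c i) = 1" using isometry_vnorm[OF P] by simp
    have "(vnorm (M *\<^sub>v (P *\<^sub>v unit_vec c i)))\<^sup>2 = (sv_min M)\<^sup>2"
      using eq[of "unit_vec c i"] u[of "\<lambda>k. (\<sigma> k)\<^sup>2"] i by simp
    then show "vnorm (M *\<^sub>v (P *\<^sub>v unit_vec c i)) = sv_min M"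
      using pos[of i] i by (simp add: power2_eq_iff_nonneg)
  qed
qed

lemma sv_min_nonneg:
  assumes "M \<in> carrier_mat r c" "c \<le> r" "1 \<le> c"
  shows "0 \<le> sv_min M"
  using sv_min_attained[OF assms] vnorm_nonneg by metis

text \<open>Sorting preserves counts, so the multiplicity of \<open>s\<close> is the number of
  indices \<open>i\<close> with \<open>\<sigma> i = s\<close>.\<close>

lemma simple_sv_unique:
  assumes "singular_values M = sort (map \<sigma> [0..<c])" "simple_sv M s"
    and "i < c" "k < c" "\<sigma> i = s" "\<sigma> k = s"
  shows "i = k"
proof -
  have "count_list (sort (map \<sigma> [0..<c])) s = count_list (map \<sigma> [0..<c]) s"
    unfolding count_mset[symmetric] by simp
  also have "\<dots> = length (filter (\<lambda>i. \<sigma> i = s) [0..<c])"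
    by (simp add: count_list_eq_length_filter filter_map o_def eq_commute[of s])
  also have "\<dots> = card {i. i < c \<and> \<sigma> i = s}"
    by (simp add: length_filter_conv_card cong: conj_cong)
  finally have "count_list (sort (map \<sigma> [0..<c])) s = card {i. i < c \<and> \<sigma> i = s}" .
  then have "card {i. i < c \<and> \<sigma> i = s} = 1" using assms by (simp add: simple_sv_def)
  then obtain a where "{i. i < c \<and> \<sigma> i = s} = {a}" by (auto simp: card_1_singleton_iff)
  moreover have "i \<in> {i. i < c \<and> \<sigma> i = s}" "k \<in> {i. i < c \<and> \<sigma> i = s}"
    using assms(3-6) by simp_all
  ultimately show ?thesis by simp
qed

text \<open>Simplicity leaves a single index \<open>i\<close> with
  \<open>\<sigma> i = sv_min M\<close>, so the eigenvector \<open>v\<close> is a multiple of the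
  \<open>i\<close>-th column of \<open>P\<close>. A vector orthogonal to \<open>v\<close> has no
  coordinate there and meets only the larger \<open>\<sigma> k\<close>.\<close>

lemma simple_sv_min_gap:
  assumes M: "M \<in> carrier_mat r c" and "c \<le> r" "1 \<le> c" and simple: "simple_sv M (sv_min M)"
    and v: "v \<in> carrier_vec c" "vnorm v = 1"
    and ev: "mat_adjoint M *\<^sub>v (M *\<^sub>v v) = of_real ((sv_min M)\<^sup>2) \<cdot>\<^sub>v v"
  obtains \<delta> where "\<delta> > 0"
    "\<And>z. z \<in> carrier_vec c \<Longrightarrow> z \<bullet>c v = 0 \<Longrightarrow> ((sv_min M)\<^sup>2 + \<delta>) * (vnorm z)\<^sup>2 \<le> (vnorm (M *\<^sub>v z))\<^sup>2"
proof -
  obtain P \<sigma> where P: "P \<in> carrier_mat c c" "mat_adjoint P * P = 1\<^sub>m c" and pos: "\<And>i. 0 \<le> \<sigma> i"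
    and sv: "singular_values M = sort (map \<sigma> [0..<c])"
    and D: "mat_adjoint P * (mat_adjoint M * M) * P = mat_diag c (\<lambda>i. of_real ((\<sigma> i)\<^sup>2))"
    and eq: "\<And>y. y \<in> carrier_vec c \<Longrightarrow> (vnorm (M *\<^sub>v (P *\<^sub>v y)))\<^sup>2 = (\<Sum>i<c. (\<sigma> i)\<^sup>2 * (cmod (y $ i))\<^sup>2)"
    by (rule singular_value_decomposition[OF M \<open>c \<le> r\<close>]) (rule that)
  define s where "s = sv_min M"
  obtain i where i: "i < c" "\<sigma> i = s" using sv_min_is_minimum[OF sv \<open>1 \<le> c\<close>] unfolding s_def by blast
  have s0: "0 \<le> s" using i pos by metis
  have larger: "s < \<sigma> k" if "k < c" "k \<noteq> i" for k
    using simple_sv_unique[OF sv simple, of k i] sv_min_is_minimum(2)[OF sv \<open>1 \<le> c\<close>, of k] that i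
    by (fastforce simp: s_def)
  define b where "b = mat_adjoint P *\<^sub>v v"
  have b: "b \<in> carrier_vec c" using P v by (auto simp: b_def intro!: mult_mat_vec_carrier[OF adjoint_carrier])
  have vb: "v = P *\<^sub>v b" unfolding b_def by (rule unitary_preimage[OF P v(1)])
  have "mat_diag c (\<lambda>i. of_real ((\<sigma> i)\<^sup>2)) *\<^sub>v b = of_real (s\<^sup>2) \<cdot>\<^sub>v b"
  proof -
    have "mat_adjoint M * M *\<^sub>v v = mat_adjoint M *\<^sub>v (M *\<^sub>v v)"
      using M v by (intro assoc_mult_mat_vec) auto
    moreover have "mat_diag c (\<lambda>i. of_real ((\<sigma> i)\<^sup>2)) *\<^sub>v b = mat_adjoint P *\<^sub>v (mat_adjoint M * M *\<^sub>v v)"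
      unfolding D[symmetric] vb using P(1) M b by (intro mult_mat_vec_assoc3) auto
    ultimately have "mat_diag c (\<lambda>i. of_real ((\<sigma> i)\<^sup>2)) *\<^sub>v b
        = mat_adjoint P *\<^sub>v (mat_adjoint M *\<^sub>v (M *\<^sub>v v))" by simp
    also have "\<dots> = of_real (s\<^sup>2) \<cdot>\<^sub>v b"
      unfolding ev b_def s_def using P(1) v by (intro mult_mat_vec) auto
    finally show ?thesis .
  qed
  moreover have "(mat_diag c (\<lambda>i. complex_of_real ((\<sigma> i)\<^sup>2)) *\<^sub>v b) $ k = of_real ((\<sigma> k)\<^sup>2) * b $ k"
    if "k < c" for k
    using that b by (simp add: mat_diag_def scalar_prod_def if_distrib[of "\<lambda>t. t * _"] cong: if_cong)
  \<comment> \<open>Coordinates of the eigenvector equation: \<open>b $ k\<close> can be nonzero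
    only where \<open>\<sigma> k = s\<close>.\<close>
  ultimately have bk: "complex_of_real ((\<sigma> k)\<^sup>2) * b $ k = of_real (s\<^sup>2) * b $ k" if "k < c" for k
    using that b by (metis carrier_vecD index_smult_vec(1))
  have b0: "b $ k = 0" if "k < c" "k \<noteq> i" for k
  proof -
    have "s\<^sup>2 < (\<sigma> k)\<^sup>2" using larger[OF that] s0 by (intro power_strict_mono) auto
    then show ?thesis using bk[OF that(1)] by (metis less_irrefl mult_cancel_right of_real_eq_iff)
  qed
  have bi: "b $ i \<noteq> 0"
  proof
    assume "b $ i = 0"
    then have "b = 0\<^sub>v c" using b b0 by (intro eq_vecI) auto
    then have "vnorm b = 0" using vnorm_eq_0[OF b] by simp
    then show False using v(2) isometry_vnorm[OF P b] vb by simp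
  qed
  \<comment> \<open>The 1 keeps the set nonempty when \<open>c = 1\<close>; then no other index
    exists and \<open>z\<close> is zero.\<close>
  define S where "S = insert 1 ((\<lambda>k. (\<sigma> k)\<^sup>2 - s\<^sup>2) ` ({..<c} - {i}))"
  have S: "finite S" "S \<noteq> {}" by (auto simp: S_def)
  show ?thesis
  proof (rule that[of "Min S"])
    have "s\<^sup>2 < (\<sigma> k)\<^sup>2" if "k < c" "k \<noteq> i" for k
      using larger[OF that] s0 by (intro power_strict_mono) auto
    then show "Min S > 0" using S by (auto simp: S_def)
    fix z assume z: "z \<in> carrier_vec c" "z \<bullet>c v = 0"
    define y where "y = mat_adjoint P *\<^sub>v z"
    have y: "y \<in> carrier_vec c" using P z by (auto simp: y_def intro!: mult_mat_vec_carrier[OF adjoint_carrier])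
    have zy: "z = P *\<^sub>v y" unfolding y_def by (rule unitary_preimage[OF P z(1)])
    have "0 = y \<bullet>c b" using z(2) isometry_cip[OF P y b] unfolding zy vb by simp
    also have "\<dots> = (\<Sum>k<c. if k = i then y $ i * cnj (b $ i) else 0)"
      unfolding cip_sum using b b0 by (intro sum.cong) auto
    finally have yi: "y $ i = 0" using bi i by simp
    have "((sv_min M)\<^sup>2 + Min S) * (vnorm z)\<^sup>2 = (\<Sum>k<c. (s\<^sup>2 + Min S) * (cmod (y $ k))\<^sup>2)"
      unfolding zy isometry_vnorm[OF P y] vnorm_sq_sum s_def using y by (simp add: sum_distrib_left)
    also have "\<dots> \<le> (\<Sum>k<c. (\<sigma> k)\<^sup>2 * (cmod (y $ k))\<^sup>2)"
    proof (rule sum_mono)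
      fix k assume k: "k \<in> {..<c}"
      show "(s\<^sup>2 + Min S) * (cmod (y $ k))\<^sup>2 \<le> (\<sigma> k)\<^sup>2 * (cmod (y $ k))\<^sup>2"
      proof (cases "k = i")
        case False
        then have "Min S \<le> (\<sigma> k)\<^sup>2 - s\<^sup>2" using k S(1) by (intro Min_le) (auto simp: S_def)
        then show ?thesis by (intro mult_right_mono) auto
      qed (simp add: yi)
    qed
    also have "\<dots> = (vnorm (M *\<^sub>v z))\<^sup>2" by (simp add: eq[OF y] zy)
    finally show "((sv_min M)\<^sup>2 + Min S) * (vnorm z)\<^sup>2 \<le> (vnorm (M *\<^sub>v z))\<^sup>2" .
  qed
qed

subsection \<open>Orthonormal bases\<close>

lemma isometry_dim_le:
  assumes V: "V \<in> carrier_mat n d" and VV: "mat_adjoint V * V = (1\<^sub>m d :: cmat)"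
  shows "d \<le> n"
proof (rule ccontr)
  assume "\<not> d \<le> n"
  then have nd: "n < d" by simp
  \<comment> \<open>Padding \<open>V\<close> with zero rows gives a unitary matrix with a zero row.\<close>
  define W where "W = Matrix.mat d d (\<lambda>(i, j). if i < n then V $$ (i, j) else 0)"
  have W: "W \<in> carrier_mat d d" by (simp add: W_def)
  have "mat_adjoint W * W = mat_adjoint V * V"
  proof (rule eq_matI)
    fix i j assume "i < dim_row (mat_adjoint V * V)" "j < dim_col (mat_adjoint V * V)"
    then have ij: "i < d" "j < d" using V by auto
    have "(mat_adjoint W * W) $$ (i, j)
        = (\<Sum>k<d. if k < n then cnj (V $$ (k, i)) * V $$ (k, j) else 0)"
      using ij W by (auto simp: scalar_prod_def atLeast0LessThan W_def intro!: sum.cong)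
    also have "\<dots> = (\<Sum>k<n. cnj (V $$ (k, i)) * V $$ (k, j))"
      using nd by (intro sum.mono_neutral_cong_right) auto
    also have "\<dots> = (mat_adjoint V * V) $$ (i, j)"
      using ij V by (auto simp: scalar_prod_def atLeast0LessThan intro!: sum.cong)
    finally show "(mat_adjoint W * W) $$ (i, j) = (mat_adjoint V * V) $$ (i, j)" .
  qed (use V W in auto)
  then have "W * mat_adjoint W = 1\<^sub>m d"
    using unitary_right_inverse[OF W] VV by simp
  then have "(W * mat_adjoint W) $$ (n, n) = 1" using nd by simp
  moreover have "(W * mat_adjoint W) $$ (n, n) = 0"
    using nd W by (auto simp: scalar_prod_def W_def)
  ultimately show False by simp
qed

text \<open>A vector of \<open>S\<close> is \<open>V y\<close> for some \<open>y\<close>, and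
  orthonormality of the columns identifies \<open>y\<close>. So \<open>V\<close> after its adjoint
  fixes \<open>S\<close>, and the adjoint preserves norms on \<open>S\<close>.\<close>

lemma onb_mat_expand:
  assumes "onb_mat n S V" "x \<in> S"
  shows "x = V *\<^sub>v (mat_adjoint V *\<^sub>v x)" "mat_adjoint V *\<^sub>v x \<in> carrier_vec (dim_col V)"
    "x \<in> carrier_vec n" "vnorm (mat_adjoint V *\<^sub>v x) = vnorm x"
proof -
  interpret vec_space "TYPE(complex)" n .
  have V: "V \<in> carrier_mat n (dim_col V)" and VV: "mat_adjoint V * V = 1\<^sub>m (dim_col V)"
    using assms(1) unfolding onb_mat_def by (blast intro: carrier_matI)+
  have "x \<in> col_space V" using assms by (simp add: onb_mat_def col_space_def)
  then obtain y where y: "y \<in> carrier_vec (dim_col V)" "V *\<^sub>v y = x"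
    using col_space_eq[OF V] by auto
  have "mat_adjoint V *\<^sub>v x = mat_adjoint V * V *\<^sub>v y"
    unfolding y(2)[symmetric] by (rule assoc_mult_mat_vec[OF adjoint_carrier[OF V] V y(1), symmetric])
  then have xy: "mat_adjoint V *\<^sub>v x = y" using VV y by simp
  show "x = V *\<^sub>v (mat_adjoint V *\<^sub>v x)" unfolding xy by (rule y(2)[symmetric])
  show "mat_adjoint V *\<^sub>v x \<in> carrier_vec (dim_col V)" unfolding xy by (rule y(1))
  show "x \<in> carrier_vec n" using mult_mat_vec_carrier[OF V y(1)] unfolding y(2) .
  show "vnorm (mat_adjoint V *\<^sub>v x) = vnorm x"
    using isometry_vnorm[OF V VV y(1)] unfolding xy y(2) by (rule sym)
qed

text \<open>With \<open>?y\<close> the image of \<open>x\<close>,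
  \<open>\<bar>?y\<bar>\<^sup>2\<close> is the inner product of \<open>V ?y\<close> with
  \<open>x\<close>; Cauchy-Schwarz and \<open>\<bar>V ?y\<bar> = \<bar>?y\<bar>\<close> bound it by
  \<open>\<bar>?y\<bar> \<bar>x\<bar>\<close>.\<close>

lemma isometry_adjoint_vnorm_le:
  assumes V: "V \<in> carrier_mat n d" and VV: "mat_adjoint V * V = (1\<^sub>m d :: cmat)" and x: "x \<in> carrier_vec n"
  shows "vnorm (mat_adjoint V *\<^sub>v x) \<le> vnorm x"
proof -
  let ?y = "mat_adjoint V *\<^sub>v x"
  have y: "?y \<in> carrier_vec d" using V x by (intro mult_mat_vec_carrier[OF adjoint_carrier])
  have "(V *\<^sub>v ?y) \<bullet>c x = ?y \<bullet>c ?y" by (rule cip_adjoint[OF V y x])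
  then have "(vnorm ?y)\<^sup>2 = cmod ((V *\<^sub>v ?y) \<bullet>c x)" by (simp add: cip_self norm_power)
  also have "\<dots> \<le> vnorm (V *\<^sub>v ?y) * vnorm x"
    using V y x by (intro cip_Cauchy_Schwarz[of _ n]) auto
  also have "vnorm (V *\<^sub>v ?y) = vnorm ?y" by (rule isometry_vnorm[OF V VV y])
  finally show ?thesis
    using vnorm_nonneg[of ?y] vnorm_nonneg[of x] by (cases "vnorm ?y = 0") (auto simp: power2_eq_square)
qed

lemma cspan_superset:
  assumes "X \<subseteq> carrier_vec n" "x \<in> X"
  shows "x \<in> cspan n X"
proof -
  interpret vec_space "TYPE(complex)" n .
  show ?thesis using in_own_span[of X] assms by auto
qed

lemma cspan_zero: "0\<^sub>v n \<in> cspan n X"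
proof -
  interpret vec_space "TYPE(complex)" n .
  show ?thesis using span_zero by auto
qed

lemma cspan_carrier:
  assumes "X \<subseteq> carrier_vec n"
  shows "cspan n X \<subseteq> carrier_vec n"
proof -
  interpret vec_space "TYPE(complex)" n .
  show ?thesis using span_closed[of X] assms by auto
qed

text \<open>The radicand becomes a squared norm once the outer factors are moved across the inner
  product. For orthonormal columns of \<open>U\<close> the value is the length of the projection of
  \<open>A V w\<close> onto their span.\<close>

lemma sigma_VU_eq:
  assumes "A \<in> carrier_mat n n" "V \<in> carrier_mat n d" "U \<in> carrier_mat n e" "w \<in> carrier_vec d"
  shows "sigma_VU A V U w = vnorm (mat_adjoint U *\<^sub>v (A *\<^sub>v (V *\<^sub>v w)))"
proof -
  define y where "y = A *\<^sub>v (V *\<^sub>v w)"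
  define t where "t = mat_adjoint U *\<^sub>v y"
  have y: "y \<in> carrier_vec n" using assms by (auto simp: y_def)
  have t: "t \<in> carrier_vec e" unfolding t_def using assms(3) y by (intro mult_mat_vec_carrier[OF adjoint_carrier])
  have Vw: "V *\<^sub>v w \<in> carrier_vec n" and Ut: "U *\<^sub>v t \<in> carrier_vec n" using assms t by auto
  have AUt: "mat_adjoint A *\<^sub>v (U *\<^sub>v t) \<in> carrier_vec n"
    using assms(1) Ut by (intro mult_mat_vec_carrier[OF adjoint_carrier])
  have "(mat_adjoint V *\<^sub>v (mat_adjoint A *\<^sub>v (U *\<^sub>v t))) \<bullet>c w = (mat_adjoint A *\<^sub>v (U *\<^sub>v t)) \<bullet>c (V *\<^sub>v w)"
    using cip_adjoint[of "mat_adjoint V" d n "mat_adjoint A *\<^sub>v (U *\<^sub>v t)" w] assms(2,4) AUt by simp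
  also have "\<dots> = (U *\<^sub>v t) \<bullet>c y"
    using cip_adjoint[of "mat_adjoint A" n n "U *\<^sub>v t" "V *\<^sub>v w"] assms(1) Ut Vw by (simp add: y_def)
  also have "\<dots> = t \<bullet>c t"
    using cip_adjoint[OF assms(3) t y] unfolding t_def .
  finally show ?thesis by (simp add: sigma_VU_def vnorm_def flip: t_def y_def)
qed

subsection \<open>Second order lower bound\<close>

text \<open>For \<open>y = \<alpha> v + z\<close> with \<open>z\<close> orthogonal to
  \<open>v\<close>: \<open>a\<close>, \<open>b\<close> are \<open>\<bar>\<alpha>\<bar>\<close>,
  \<open>\<bar>z\<bar>\<close>; \<open>P\<close>, \<open>Q\<close> are the norms of
  \<open>A v\<close>, \<open>A z\<close>; \<open>X\<close> is the cross term; \<open>K\<close> is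
  the size of the unperturbed matrix and \<open>e\<close> that of the perturbation. Hypothesis
  \<open>le\<close> gives \<open>Q\<^sup>2 - b\<^sup>2 * P\<^sup>2 \<le> - 2 * X\<close>. By the gap
  the left side is at least \<open>b\<^sup>2 * \<delta> / 2\<close>, the right side is of order
  \<open>e * b\<close>, and one factor \<open>b\<close> cancels.\<close>

lemma perturbation_arith:
  fixes a b s K e \<delta> P Q X L :: real
  assumes "0 \<le> a" "0 \<le> b" "a\<^sup>2 + b\<^sup>2 = 1" "0 \<le> s" "0 \<le> K" "0 \<le> e" "0 < \<delta>"
    and small: "e * (2 * K + 2 * s + 1) \<le> \<delta> / 2" and "e \<le> 1"
    and le: "a\<^sup>2 * P\<^sup>2 + 2 * X + Q\<^sup>2 \<le> P\<^sup>2"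
    and X: "- X \<le> (s + K + 1) * e * b"
    and Q: "(s\<^sup>2 + \<delta>) * b\<^sup>2 - 2 * K * e * b\<^sup>2 \<le> Q\<^sup>2"
    and P: "0 \<le> P" "P \<le> s + e"
  shows "b \<le> 4 * (s + K + 1) / \<delta> * e"
proof (cases "b = 0")
  case False
  have "P\<^sup>2 \<le> (s + e)\<^sup>2" using P by (intro power_mono) auto
  \<comment> \<open>\<open>e \<le> 1\<close> replaces \<open>e\<^sup>2\<close> by
    \<open>e\<close>.\<close>
  also have "\<dots> \<le> s\<^sup>2 + e * (2 * s + 1)"
    using mult_left_mono[of e 1 e] assms by (simp add: power2_eq_square algebra_simps)
  finally have "b\<^sup>2 * P\<^sup>2 \<le> b\<^sup>2 * (s\<^sup>2 + e * (2 * s + 1))" by (intro mult_left_mono) auto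
  moreover have "Q\<^sup>2 - b\<^sup>2 * P\<^sup>2 \<le> - 2 * X"
  proof -
    have "P\<^sup>2 = (a\<^sup>2 + b\<^sup>2) * P\<^sup>2" using assms by simp
    then show ?thesis using le by (simp add: algebra_simps)
  qed
  ultimately have "b\<^sup>2 * (\<delta> - e * (2 * K + 2 * s + 1)) \<le> 2 * ((s + K + 1) * e * b)"
    using X Q by (simp add: algebra_simps)
  moreover have "b\<^sup>2 * (\<delta> / 2) \<le> b\<^sup>2 * (\<delta> - e * (2 * K + 2 * s + 1))"
    using small by (intro mult_left_mono) auto
  ultimately have "b * (b * \<delta>) \<le> b * (4 * (s + K + 1) * e)"
    by (simp add: power2_eq_square algebra_simps)
  then have "b * \<delta> \<le> 4 * (s + K + 1) * e"
    using False assms(2) by simp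
  then show ?thesis using \<open>0 < \<delta>\<close> by (simp add: field_simps)
qed (use assms in simp)

text \<open>Write \<open>y = \<alpha> v + z\<close> with \<open>z\<close> orthogonal to
  \<open>v\<close>. The singular vector equations make \<open>A0 v\<close> orthogonal to
  \<open>A0 z\<close>, so the cross term is small and \<open>perturbation_arith\<close> gives
  \<open>\<bar>z\<bar> \<le> L * e\<close>. The loss in \<open>u\<^sup>* A y\<close> is then
  quadratic in \<open>e\<close>: \<open>1 - \<bar>\<alpha>\<bar>\<close> is at most
  \<open>\<bar>z\<bar>\<^sup>2\<close>, and \<open>u\<^sup>* A z\<close> sees only the perturbation
  since \<open>u\<^sup>* A0 z = s v\<^sup>* z = 0\<close>.\<close>

lemma perturbed_lower_bound:
  fixes A A0 :: cmat
  assumes A0: "A0 \<in> carrier_mat n n" and A: "A \<in> carrier_mat n n"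
    and u: "u \<in> carrier_vec n" "vnorm u = 1" and v: "v \<in> carrier_vec n" "vnorm v = 1"
    and s: "0 \<le> s" "A0 *\<^sub>v v = of_real s \<cdot>\<^sub>v u" "mat_adjoint A0 *\<^sub>v u = of_real s \<cdot>\<^sub>v v"
    and gap: "0 < \<delta>" "\<And>z. z \<in> carrier_vec n \<Longrightarrow> z \<bullet>c v = 0 \<Longrightarrow> (s\<^sup>2 + \<delta>) * (vnorm z)\<^sup>2 \<le> (vnorm (A0 *\<^sub>v z))\<^sup>2"
    and e: "e = frob (A - A0)" "e \<le> 1" "e * (2 * frob A0 + 2 * s + 1) \<le> \<delta> / 2"
    and L: "L = 4 * (s + frob A0 + 1) / \<delta>"
    and y: "y \<in> carrier_vec n" "vnorm y = 1" "vnorm (A *\<^sub>v y) \<le> vnorm (A *\<^sub>v v)"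
  shows "cmod ((A *\<^sub>v v) \<bullet>c u) - (L\<^sup>2 * (s + 1) + L) * e\<^sup>2 \<le> cmod ((A *\<^sub>v y) \<bullet>c u)"
proof -
  define K where "K = frob A0"
  define E where "E = A - A0"
  have K0: "0 \<le> K" and e0: "0 \<le> e" by (auto simp: K_def e(1))
  have E: "E \<in> carrier_mat n n" using A A0 by (simp add: E_def minus_carrier_mat)
  have AE: "A *\<^sub>v x = A0 *\<^sub>v x + E *\<^sub>v x" if "x \<in> carrier_vec n" for x
  proof -
    have "A = A0 + E" using A A0 by (intro eq_matI) (auto simp: E_def)
    then show ?thesis using add_mult_distrib_mat_vec[OF A0 E that] by simp
  qed
  have Eb: "vnorm (E *\<^sub>v x) \<le> e * vnorm x" if "x \<in> carrier_vec n" for x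
    using vnorm_mult_le_frob[OF E that] by (simp add: e(1) E_def)
  have Kb: "vnorm (A0 *\<^sub>v x) \<le> K * vnorm x" if "x \<in> carrier_vec n" for x
    using vnorm_mult_le_frob[OF A0 that] by (simp add: K_def)
  define \<alpha> where "\<alpha> = y \<bullet>c v"
  define z where "z = y - \<alpha> \<cdot>\<^sub>v v"
  have z: "z \<in> carrier_vec n" using y v by (simp add: z_def)
  have av: "\<alpha> \<cdot>\<^sub>v v \<in> carrier_vec n" using v by simp
  have yz: "y = \<alpha> \<cdot>\<^sub>v v + z" using y v by (intro eq_vecI) (auto simp: z_def)
  have zv: "z \<bullet>c v = 0"
  proof -
    have "\<alpha> = \<alpha> * (v \<bullet>c v) + z \<bullet>c v"
      using v z av unfolding \<alpha>_def[symmetric]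
      by (metis \<alpha>_def yz cip_add_left cip_smult_left)
    then show ?thesis using v by (simp add: cip_self)
  qed
  define a where "a = cmod \<alpha>"
  define b where "b = vnorm z"
  have a0: "0 \<le> a" and b0: "0 \<le> b" by (auto simp: a_def b_def)
  have vz: "v \<bullet>c z = 0" using cip_swap[OF z v(1)] zv by simp
  have ab: "a\<^sup>2 + b\<^sup>2 = 1"
    using vnorm_add_sq[OF av z] y(2) v yz vz
    by (simp add: vnorm_smult a_def b_def cip_smult_left[of _ n, OF v(1) z])
  have a1: "a \<le> 1" using ab a0 by (metis abs_square_le_1 abs_of_nonneg le_add_same_cancel1 zero_le_power2)
  define p where "p = A *\<^sub>v v"
  define q where "q = A *\<^sub>v z"
  have p: "p \<in> carrier_vec n" and q: "q \<in> carrier_vec n" using A z v(1) by (auto simp: p_def q_def)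
  have Az: "A0 *\<^sub>v z \<in> carrier_vec n" "E *\<^sub>v z \<in> carrier_vec n" "E *\<^sub>v v \<in> carrier_vec n"
    "A0 *\<^sub>v v \<in> carrier_vec n" using A0 E z v(1) by auto
  have Ay: "A *\<^sub>v y = \<alpha> \<cdot>\<^sub>v p + q"
    unfolding yz p_def q_def using A v z av by (simp add: mult_add_distrib_mat_vec[of _ n n] mult_mat_vec[of _ n n])
  have A0zu: "(A0 *\<^sub>v z) \<bullet>c u = 0"
    using cip_adjoint[OF A0 z u(1)] zv by (simp add: s(3) cip_smult_right[OF v(1) z])
  have uA0z: "u \<bullet>c (A0 *\<^sub>v z) = 0"
    using cip_swap[OF Az(1) u(1)] A0zu by simp
  have A0v: "vnorm (A0 *\<^sub>v v) = s" using s u by (simp add: vnorm_smult)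
  \<comment> \<open>Splitting \<open>A = A0 + E\<close> on both sides gives four terms. The first
    vanishes because \<open>A0 v\<close> is a multiple of \<open>u\<close>; the one quadratic in
    \<open>E\<close> is made linear by \<open>e \<le> 1\<close>, whence the 1 in
    \<open>s + K + 1\<close>.\<close>
  have pq: "cmod (p \<bullet>c q) \<le> (s + K + 1) * e * b"
  proof -
    have "p \<bullet>c q = (A0 *\<^sub>v v) \<bullet>c (A0 *\<^sub>v z) + (A0 *\<^sub>v v) \<bullet>c (E *\<^sub>v z)
        + ((E *\<^sub>v v) \<bullet>c (A0 *\<^sub>v z) + (E *\<^sub>v v) \<bullet>c (E *\<^sub>v z))"
      unfolding p_def q_def AE[OF v(1)] AE[OF z] using Az
      by (simp add: cip_add_left[of _ n] cip_add_right[of _ n])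
    also have "(A0 *\<^sub>v v) \<bullet>c (A0 *\<^sub>v z) = 0"
      using uA0z by (simp add: s(2) cip_smult_left[OF u(1) Az(1)])
    finally have "cmod (p \<bullet>c q) \<le> cmod ((A0 *\<^sub>v v) \<bullet>c (E *\<^sub>v z))
        + (cmod ((E *\<^sub>v v) \<bullet>c (A0 *\<^sub>v z)) + cmod ((E *\<^sub>v v) \<bullet>c (E *\<^sub>v z)))"
      using norm_triangle_ineq[of "(A0 *\<^sub>v v) \<bullet>c (E *\<^sub>v z)" "(E *\<^sub>v v) \<bullet>c (A0 *\<^sub>v z) + (E *\<^sub>v v) \<bullet>c (E *\<^sub>v z)"]
        norm_triangle_ineq[of "(E *\<^sub>v v) \<bullet>c (A0 *\<^sub>v z)" "(E *\<^sub>v v) \<bullet>c (E *\<^sub>v z)"]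
      by simp
    moreover have "cmod ((A0 *\<^sub>v v) \<bullet>c (E *\<^sub>v z)) \<le> s * (e * b)"
      using cip_Cauchy_Schwarz[OF Az(4,2)] mult_left_mono[OF Eb[OF z] s(1)]
      unfolding A0v b_def by linarith
    moreover have "cmod ((E *\<^sub>v v) \<bullet>c (A0 *\<^sub>v z)) \<le> e * (K * b)"
      using cip_Cauchy_Schwarz[OF Az(3,1)] mult_mono[OF Eb[OF v(1)] Kb[OF z]] e0 v(2)
      by (simp add: b_def)
    moreover have "cmod ((E *\<^sub>v v) \<bullet>c (E *\<^sub>v z)) \<le> 1 * (e * b)"
    proof -
      have "vnorm (E *\<^sub>v v) \<le> 1" using Eb[OF v(1)] v(2) e(2) by simp
      from mult_mono[OF this Eb[OF z]] show ?thesis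
        using cip_Cauchy_Schwarz[OF Az(3,2)] by (simp add: b_def)
    qed
    ultimately show ?thesis by (simp add: algebra_simps)
  qed
  have b_le: "b \<le> L * e"
    unfolding L K_def[symmetric]
  proof (rule perturbation_arith[of a b s K e \<delta> "vnorm p" "Re ((\<alpha> \<cdot>\<^sub>v p) \<bullet>c q)" "vnorm q"])
    show "e * (2 * K + 2 * s + 1) \<le> \<delta> / 2" using e(3) by (simp add: K_def)
    \<comment> \<open>The comparison of \<open>y\<close> with \<open>v\<close>, squared and expanded
      by \<open>A y = \<alpha> p + q\<close>.\<close>
    have "(vnorm (A *\<^sub>v y))\<^sup>2 \<le> (vnorm p)\<^sup>2" using y(3) by (intro power_mono) (auto simp: p_def)
    then show "a\<^sup>2 * (vnorm p)\<^sup>2 + 2 * Re ((\<alpha> \<cdot>\<^sub>v p) \<bullet>c q) + (vnorm q)\<^sup>2 \<le> (vnorm p)\<^sup>2"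
      unfolding Ay using vnorm_add_sq[of "\<alpha> \<cdot>\<^sub>v p" n q] p q
      by (simp add: vnorm_smult a_def power_mult_distrib)
    have "- Re ((\<alpha> \<cdot>\<^sub>v p) \<bullet>c q) \<le> cmod ((\<alpha> \<cdot>\<^sub>v p) \<bullet>c q)"
      using abs_Re_le_cmod[of "(\<alpha> \<cdot>\<^sub>v p) \<bullet>c q"] by linarith
    also have "\<dots> = a * cmod (p \<bullet>c q)" by (simp add: cip_smult_left[OF p q] norm_mult a_def)
    also have "\<dots> \<le> cmod (p \<bullet>c q)" using a0 a1 by (simp add: mult_left_le_one_le)
    finally show "- Re ((\<alpha> \<cdot>\<^sub>v p) \<bullet>c q) \<le> (s + K + 1) * e * b" using pq by linarith
    \<comment> \<open>\<open>\<bar>A z\<bar>\<^sup>2\<close> is expanded around \<open>A0 z\<close>: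
      the gap bounds the main term from below and the square of \<open>E z\<close> is discarded as
      nonnegative.\<close>
    have "cmod ((A0 *\<^sub>v z) \<bullet>c (E *\<^sub>v z)) \<le> (K * b) * (e * b)"
      using cip_Cauchy_Schwarz[OF Az(1,2)] mult_mono[OF Kb[OF z] Eb[OF z]] K0 b0
      by (simp add: b_def)
    moreover have "- Re ((A0 *\<^sub>v z) \<bullet>c (E *\<^sub>v z)) \<le> cmod ((A0 *\<^sub>v z) \<bullet>c (E *\<^sub>v z))"
      using abs_Re_le_cmod[of "(A0 *\<^sub>v z) \<bullet>c (E *\<^sub>v z)"] by linarith
    moreover have "(vnorm q)\<^sup>2 = (vnorm (A0 *\<^sub>v z))\<^sup>2 + 2 * Re ((A0 *\<^sub>v z) \<bullet>c (E *\<^sub>v z)) + (vnorm (E *\<^sub>v z))\<^sup>2"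
      unfolding q_def AE[OF z] by (rule vnorm_add_sq[OF Az(1,2)])
    moreover have "(s\<^sup>2 + \<delta>) * b\<^sup>2 \<le> (vnorm (A0 *\<^sub>v z))\<^sup>2" unfolding b_def by (rule gap(2)[OF z zv])
    moreover have "0 \<le> (vnorm (E *\<^sub>v z))\<^sup>2" by simp
    moreover have "(K * b) * (e * b) = K * e * b\<^sup>2" by (simp add: power2_eq_square)
    ultimately show "(s\<^sup>2 + \<delta>) * b\<^sup>2 - 2 * K * e * b\<^sup>2 \<le> (vnorm q)\<^sup>2" by linarith
    show "vnorm p \<le> s + e"
      using vnorm_triangle[OF Az(4,3)] Eb[OF v(1)] v(2) A0v by (simp add: p_def AE[OF v(1)])
  qed (use a0 b0 ab s K0 e0 gap e in auto)
  have "(A *\<^sub>v y) \<bullet>c u = \<alpha> * (p \<bullet>c u) + q \<bullet>c u"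
    unfolding Ay using p q u by (simp add: cip_add_left[of _ n] cip_smult_left[of _ n])
  moreover have "q \<bullet>c u = (E *\<^sub>v z) \<bullet>c u"
    unfolding q_def AE[OF z] using Az u A0zu by (simp add: cip_add_left[of _ n])
  moreover have "cmod ((E *\<^sub>v z) \<bullet>c u) \<le> e * b"
    using cip_Cauchy_Schwarz[OF Az(2) u(1)] Eb[OF z] u(2) by (simp add: b_def)
  ultimately have low: "a * cmod (p \<bullet>c u) - e * b \<le> cmod ((A *\<^sub>v y) \<bullet>c u)"
    using norm_diff_ineq[of "\<alpha> * (p \<bullet>c u)" "q \<bullet>c u"] by (simp add: norm_mult a_def)
  have pu: "cmod (p \<bullet>c u) \<le> s + 1"
  proof -
    have "vnorm p \<le> s + e"
      using vnorm_triangle[OF Az(4,3)] Eb[OF v(1)] v(2) A0v by (simp add: p_def AE[OF v(1)])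
    then show ?thesis using cip_Cauchy_Schwarz[OF p u(1)] u(2) e(2) by simp
  qed
  \<comment> \<open>\<open>a\<^sup>2 \<le> a\<close> on the unit interval, so the first term loses
    at most \<open>b\<^sup>2 * cmod (p \<bullet>c u)\<close>. Adding \<open>e * b\<close> and
    inserting \<open>b \<le> L * e\<close> yields the constant
    \<open>L\<^sup>2 * (s + 1) + L\<close>.\<close>
  have "1 - b\<^sup>2 \<le> a"
    using mult_left_le_one_le[of a a] a0 a1 ab by (simp add: power2_eq_square)
  then have "(1 - b\<^sup>2) * cmod (p \<bullet>c u) \<le> a * cmod (p \<bullet>c u)" by (intro mult_right_mono) auto
  moreover have "b\<^sup>2 * cmod (p \<bullet>c u) \<le> (L * e)\<^sup>2 * (s + 1)"
    using b_le b0 pu by (intro mult_mono power_mono) auto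
  moreover have "e * b \<le> e * (L * e)" using b_le e0 by (rule mult_left_mono)
  ultimately show ?thesis
    using low unfolding p_def by (simp add: algebra_simps power2_eq_square)
qed

subsection \<open>Differentiability\<close>

text \<open>Nothing is asked of \<open>F\<close> beyond the two bounds, so it may be built from
  discontinuous selections. Near \<open>x\<close> the difference \<open>q - L\<close> is
  nonnegative, with value 0 at \<open>x\<close>, so its derivative there is zero; the remainder of
  \<open>F\<close> lies between those of \<open>L\<close> and \<open>q\<close>.\<close>

lemma has_derivative_sandwich:
  fixes F L q :: "'a :: real_normed_vector \<Rightarrow> real"
  assumes L: "(L has_derivative L') (at x)" and q: "(q has_derivative q') (at x)"
    and eq: "L x = q x"
    and bnd: "eventually (\<lambda>y. L y \<le> F y \<and> F y \<le> q y) (nhds x)"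
  shows "(F has_derivative q') (at x)"
proof -
  obtain S where S: "open S" "x \<in> S" and le: "\<And>y. y \<in> S \<Longrightarrow> L y \<le> F y" "\<And>y. y \<in> S \<Longrightarrow> F y \<le> q y"
    using bnd unfolding eventually_nhds by blast
  have "(\<lambda>v. q' v - L' v) = (\<lambda>v. 0)"
    using S(2,1) has_derivative_diff[OF q L]
  proof (rule differential_zero_maxmin)
    have "q x - L x \<le> q y - L y" if "y \<in> S" for y
      using le[OF that] eq by simp
    then show "(\<forall>y\<in>S. q y - L y \<le> q x - L x) \<or> (\<forall>y\<in>S. q x - L x \<le> q y - L y)" by blast
  qed
  then have Lq: "L' = q'" by (auto simp: fun_eq_iff)
  \<comment> \<open>\<open>nhds x\<close> includes \<open>x\<close> itself, so the bounds fix the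
    value of \<open>F\<close> there.\<close>
  have Fx: "F x = q x" using le[OF S(2)] eq by simp
  have "((\<lambda>y. norm ((L y - L x) - q' (y - x)) / norm (y - x)
      + norm ((q y - q x) - q' (y - x)) / norm (y - x)) \<longlongrightarrow> 0 + 0) (at x)"
    using L q unfolding Lq has_derivative_iff_norm by (intro tendsto_add) auto
  then have lim: "((\<lambda>y. norm ((L y - L x) - q' (y - x)) / norm (y - x)
      + norm ((q y - q x) - q' (y - x)) / norm (y - x)) \<longlongrightarrow> 0) (at x)" by simp
  obtain e where e: "e > 0" "ball x e \<subseteq> S" using S openE by blast
  show ?thesis
  proof (rule has_derivativeI_sandwich[OF e(1) _ _ lim])
    show "bounded_linear q'" using q by (rule has_derivative_bounded_linear)
    fix y assume "dist y x < e"
    then have "y \<in> S" using e by (auto simp: dist_commute)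
    \<comment> \<open>A number between two others is bounded in modulus by the sum of their
      moduli.\<close>
    from le[OF this] have "norm ((F y - F x) - q' (y - x))
        \<le> norm ((L y - L x) - q' (y - x)) + norm ((q y - q x) - q' (y - x))"
      unfolding Fx eq real_norm_def by linarith
    then show "norm ((F y - F x) - q' (y - x)) / norm (y - x)
        \<le> norm ((L y - L x) - q' (y - x)) / norm (y - x) + norm ((q y - q x) - q' (y - x)) / norm (y - x)"
      unfolding add_divide_distrib[symmetric] by (rule divide_right_mono) simp
  qed
qed

text \<open>A linear functional is the inner product with a fixed vector, the form in which
  \<open>GDERIV\<close> states a derivative.\<close>

lemma has_derivative_imp_GDERIV:
  fixes f :: "'a :: euclidean_space \<Rightarrow> real"
  assumes "(f has_derivative f') (at x)"
  obtains g where "f' = (\<lambda>h. inner h g)"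
proof
  have "linear f'" using assms has_derivative_bounded_linear bounded_linear.linear by blast
  then show "f' = (\<lambda>h. inner h (adjoint f' 1))"
    using adjoint_works[of f' _ 1] by (auto simp: fun_eq_iff)
qed

section \<open>Real analytic functions are differentiable\<close>

lemma has_derivative_quadratic_remainder:
  fixes f :: "'a :: real_normed_vector \<Rightarrow> 'b :: real_normed_vector"
  assumes "0 < t" "bounded_linear D"
    and "\<And>y. norm (y - x) < t \<Longrightarrow> norm (f y - f x - D (y - x)) \<le> C * (norm (y - x))\<^sup>2"
  shows "(f has_derivative D) (at x)"
proof (rule has_derivativeI_sandwich[OF assms(1,2)])
  fix y assume "y \<noteq> x" "dist y x < t"
  then show "norm ((f y - f x) - D (y - x)) / norm (y - x) \<le> C * norm (y - x)"
    using assms(3)[of y] by (simp add: dist_norm field_simps power2_eq_square)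
next
  have "((\<lambda>y. C * norm (y - x)) \<longlongrightarrow> C * norm (x - x)) (at x)" by (intro tendsto_intros)
  then show "((\<lambda>y. C * norm (y - x)) \<longlongrightarrow> 0) (at x)" by simp
qed

text \<open>The multi-indices of degree at most one are \<open>0\<close> and the unit multi-indices; the rest of the
  power series is dominated by \<open>(\<bar>h\<bar> / t)\<^sup>2\<close> times its absolute value at \<open>h = (t, \<dots>, t)\<close>.\<close>

lemma real_analytic_imp_differentiable:
  fixes f :: "real ^ 'p \<Rightarrow> real"
  assumes "real_analytic f"
  shows "f differentiable (at x)"
proof -
  obtain r c where r: "r > 0" and ser: "\<And>y. norm (y - x) < r \<Longrightarrow>
      ((\<lambda>\<alpha>. c \<alpha> * (\<Prod>i\<in>UNIV. vec_nth (y - x) i ^ \<alpha> i)) has_sum f y) UNIV"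
    using assms unfolding real_analytic_def by blast
  define e :: "'p \<Rightarrow> 'p \<Rightarrow> nat" where "e i = (\<lambda>j. if j = i then 1 else 0)" for i
  define Z where "Z = insert (\<lambda>_. 0) (range e)"
  have Z: "finite Z" by (simp add: Z_def)
  have deg: "2 \<le> sum \<alpha> UNIV" if "\<alpha> \<notin> Z" for \<alpha>
  proof (rule ccontr)
    assume "\<not> 2 \<le> sum \<alpha> UNIV"
    then consider "sum \<alpha> UNIV = 0" | "sum \<alpha> UNIV = 1" by linarith
    then show False
    proof cases
      case 1
      then have "\<alpha> = (\<lambda>_. 0)" by (auto simp: fun_eq_iff)
      then show False using that by (simp add: Z_def)
    next
      case 2
      then obtain i where "\<alpha> i = 1" "\<And>j. i \<noteq> j \<Longrightarrow> \<alpha> j = 0"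
        by (subst (asm) sum_eq_1_iff) auto
      then have "\<alpha> = e i" by (auto simp: fun_eq_iff e_def)
      then show False using that by (simp add: Z_def)
    qed
  qed
  define D where "D h = (\<Sum>i\<in>UNIV. c (e i) * vec_nth h i)" for h :: "real ^ 'p"
  have D: "bounded_linear D"
    unfolding D_def by (intro bounded_linear_sum bounded_linear_const_mult bounded_linear_vec_nth)
  have low: "(\<Sum>\<alpha>\<in>Z. c \<alpha> * (\<Prod>i\<in>UNIV. vec_nth h i ^ \<alpha> i)) = c (\<lambda>_. 0) + D h" for h :: "real ^ 'p"
  proof -
    have "inj e" by (rule injI) (metis e_def zero_neq_one)
    moreover have "(\<lambda>_. 0) \<notin> range e"
      by (metis (full_types) e_def rangeE zero_neq_one)
    moreover have "(\<Prod>j\<in>UNIV. vec_nth h j ^ e i j) = vec_nth h i" for i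
      by (simp add: e_def if_distrib[of "\<lambda>k. _ ^ k"] prod.delta cong: if_cong)
    ultimately show ?thesis
      by (simp add: Z_def D_def sum.reindex)
  qed
  \<comment> \<open>A displacement with all coordinates equal to \<open>t\<close> has l1 norm
    \<open>r / 2\<close>, hence Euclidean norm below \<open>r\<close>, so the series converges
    there.\<close>
  define t where "t = r / (2 * real CARD('p))"
  have t: "t > 0" using r by (simp add: t_def)
  define S where "S = (\<Sum>\<^sub>\<infinity>\<alpha>\<in>-Z. \<bar>c \<alpha>\<bar> * t ^ sum \<alpha> UNIV)"
  have S: "((\<lambda>\<alpha>. \<bar>c \<alpha>\<bar> * t ^ sum \<alpha> UNIV) has_sum S) (-Z)"
  proof -
    let ?h = "\<chi> i. t :: real ^ 'p"
    have "norm ?h \<le> (\<Sum>i\<in>(UNIV :: 'p set). \<bar>t\<bar>)"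
      using norm_le_l1_cart[of ?h] by simp
    also have "\<dots> < r" using r t by (simp add: t_def)
    finally have "norm ((x + ?h) - x) < r" by simp
    note ser[OF this]
    moreover have "(\<Prod>i\<in>UNIV. vec_nth ((x + ?h) - x) i ^ \<alpha> i) = t ^ sum \<alpha> UNIV" for \<alpha>
      unfolding power_sum by simp
    ultimately have "((\<lambda>\<alpha>. c \<alpha> * t ^ sum \<alpha> UNIV) has_sum f (x + ?h)) UNIV"
      by simp
    then have "(\<lambda>\<alpha>. c \<alpha> * t ^ sum \<alpha> UNIV) summable_on UNIV"
      by (rule has_sum_imp_summable)
    \<comment> \<open>For real terms unconditional summability is absolute summability.\<close>
    then have "(\<lambda>\<alpha>. norm (c \<alpha> * t ^ sum \<alpha> UNIV)) summable_on UNIV"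
      by (rule iffD1[OF summable_on_iff_abs_summable_on_real])
    then have "(\<lambda>\<alpha>. norm (c \<alpha> * t ^ sum \<alpha> UNIV)) summable_on -Z"
      by (rule summable_on_subset_banach) simp
    then show ?thesis
      using t unfolding S_def by (intro has_sum_infsum) (simp add: abs_mult)
  qed
  have tr: "t < r"
  proof -
    have "1 \<le> real CARD('p)" by (simp add: Suc_leI)
    then have "1 < 2 * real CARD('p)" by linarith
    from divide_strict_left_mono[OF this r] show ?thesis by (simp add: t_def)
  qed
  have rem: "\<bar>f y - (c (\<lambda>_. 0) + D (y - x))\<bar> \<le> S / t\<^sup>2 * (norm (y - x))\<^sup>2" if y: "norm (y - x) < t" for y
  proof -
    define N where "N = norm (y - x)"
    have N: "0 \<le> N" "N < t" using y by (auto simp: N_def)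
    let ?P = "\<lambda>\<alpha>. c \<alpha> * (\<Prod>i\<in>UNIV. vec_nth (y - x) i ^ \<alpha> i)"
    have "(?P has_sum f y) UNIV" using ser y tr by simp
    \<comment> \<open>Removing the finitely many terms of degree at most one leaves a series for the
      remainder.\<close>
    then have "(?P has_sum (f y - (c (\<lambda>_. 0) + D (y - x)))) (UNIV - Z)"
      unfolding low[symmetric] using Z by (intro has_sum_Diff has_sum_finite) auto
    moreover have "((\<lambda>\<alpha>. (N / t)\<^sup>2 * (\<bar>c \<alpha>\<bar> * t ^ sum \<alpha> UNIV)) has_sum ((N / t)\<^sup>2 * S)) (UNIV - Z)"
      using has_sum_cmult_right[OF S] by (simp add: Compl_eq_Diff_UNIV)
    moreover have "norm (?P \<alpha>) \<le> (N / t)\<^sup>2 * (\<bar>c \<alpha>\<bar> * t ^ sum \<alpha> UNIV)" if "\<alpha> \<in> UNIV - Z" for \<alpha>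
    proof -
      \<comment> \<open>Each coordinate is at most \<open>N\<close> in modulus, which bounds the
        monomial by \<open>N ^ sum \<alpha> UNIV\<close>. As \<open>N / t < 1\<close> and the degree
        is at least 2, the power of \<open>N / t\<close> is at most its square.\<close>
      have "\<bar>\<Prod>i\<in>UNIV. vec_nth (y - x) i ^ \<alpha> i\<bar> = (\<Prod>i\<in>UNIV. \<bar>vec_nth (y - x) i\<bar> ^ \<alpha> i)"
        by (simp add: abs_prod power_abs)
      also have "\<dots> \<le> (\<Prod>i\<in>UNIV. N ^ \<alpha> i)"
        unfolding N_def using component_le_norm_cart[of "y - x"] by (intro prod_mono) (auto intro: power_mono)
      also have "\<dots> = (N / t) ^ sum \<alpha> UNIV * t ^ sum \<alpha> UNIV"
        using t by (simp add: power_divide flip: power_sum)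
      also have "(N / t) ^ sum \<alpha> UNIV \<le> (N / t)\<^sup>2"
        using N t deg[of \<alpha>] that by (intro power_decreasing) auto
      finally show ?thesis
        using t by (simp add: abs_mult mult_left_mono mult.left_commute)
    qed
    ultimately have "norm (f y - (c (\<lambda>_. 0) + D (y - x))) \<le> (N / t)\<^sup>2 * S"
      by (rule norm_infsum_le)
    then show ?thesis by (simp add: N_def power_divide mult.commute)
  qed
  \<comment> \<open>The remainder bound at \<open>y = x\<close> identifies the constant
    coefficient.\<close>
  have fx: "f x = c (\<lambda>_. 0)"
    using rem[of x] t linear_0[OF bounded_linear.linear[OF D]] by simp
  have "(f has_derivative D) (at x)"
  proof (rule has_derivative_quadratic_remainder[OF t D])
    show "norm (f y - f x - D (y - x)) \<le> S / t\<^sup>2 * (norm (y - x))\<^sup>2" if "norm (y - x) < t" for y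
      using rem[OF that] unfolding fx real_norm_def by (simp add: diff_diff_eq)
  qed
  then show ?thesis by (auto simp: differentiable_def)
qed

subsection \<open>Differentiability of matrix expressions\<close>

lemma differentiable_Re:
  "f differentiable F \<Longrightarrow> (\<lambda>x. Re (f x)) differentiable F"
  unfolding differentiable_def using bounded_linear.has_derivative[OF bounded_linear_Re] by blast

lemma differentiable_Im:
  "f differentiable F \<Longrightarrow> (\<lambda>x. Im (f x)) differentiable F"
  unfolding differentiable_def using bounded_linear.has_derivative[OF bounded_linear_Im] by blast

lemma differentiable_cmod_sq:
  "f differentiable (at x) \<Longrightarrow> (\<lambda>x. (cmod (f x))\<^sup>2) differentiable (at x)"
  unfolding cmod_power2
  by (intro differentiable_add differentiable_power differentiable_Re differentiable_Im)

lemma differentiable_mult_mat_vec_index: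
  fixes A :: "'a :: real_normed_vector \<Rightarrow> cmat"
  assumes A: "\<And>x. A x \<in> carrier_mat n m" and v: "v \<in> carrier_vec m" and i: "i < n"
    and diff: "\<And>a b. a < n \<Longrightarrow> b < m \<Longrightarrow> (\<lambda>x. A x $$ (a, b)) differentiable (at x0)"
  shows "(\<lambda>x. (A x *\<^sub>v v) $ i) differentiable (at x0)"
proof -
  have dims: "dim_row (A x) = n" "dim_col (A x) = m" for x using A[of x] by auto
  have "(A x *\<^sub>v v) $ i = (\<Sum>k<m. A x $$ (i, k) * v $ k)" for x
    using dims[of x] v i by (simp add: scalar_prod_def atLeast0LessThan)
  then show ?thesis
    using i diff by (auto intro!: differentiable_sum differentiable_mult)
qed

text \<open>Squared because a norm need not be differentiable where its argument vanishes, as it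
  does at \<open>x0\<close>.\<close>

lemma differentiable_frob_sq:
  fixes A :: "'a :: real_normed_vector \<Rightarrow> cmat"
  assumes A: "\<And>x. A x \<in> carrier_mat n m"
    and diff: "\<And>a b. a < n \<Longrightarrow> b < m \<Longrightarrow> (\<lambda>x. A x $$ (a, b)) differentiable (at x0)"
  shows "(\<lambda>x. (frob (A x - A x0))\<^sup>2) differentiable (at x0)"
proof -
  have dims: "dim_row (A x) = n" "dim_col (A x) = m" for x using A[of x] by auto
  have "(frob (A x - A x0))\<^sup>2 = (\<Sum>a<n. \<Sum>b<m. (cmod (A x $$ (a, b) - A x0 $$ (a, b)))\<^sup>2)" for x
    using dims by (simp add: frob_def sum_nonneg)
  then show ?thesis
    using diff by (auto intro!: differentiable_sum differentiable_cmod_sq differentiable_diff)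
qed

section \<open>The parametrised matrix\<close>

lemma param_mat_carrier [simp]: "param_mat n \<kappa> \<theta> Am x \<in> carrier_mat n n"
  by (simp add: param_mat_def)

lemma param_mat_differentiable:
  fixes \<theta> :: "nat \<Rightarrow> real ^ 'p \<Rightarrow> real"
  assumes "\<And>m. m \<in> {1..\<kappa>} \<Longrightarrow> real_analytic (\<theta> m)" and "a < n" "b < n"
  shows "(\<lambda>x. param_mat n \<kappa> \<theta> Am x $$ (a, b)) differentiable (at x0)"
proof -
  have "(\<lambda>x. complex_of_real (\<theta> m x)) differentiable (at x0)" if "m \<in> {1..\<kappa>}" for m
    using real_analytic_imp_differentiable[OF assms(1)[OF that], of x0]
    unfolding differentiable_def using has_derivative_of_real by blast
  then show ?thesis
    using assms(2,3) unfolding param_mat_def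
    by (auto intro!: differentiable_sum differentiable_mult)
qed

subsection \<open>Bounds for the reduced singular values\<close>

lemma sv_pair_vnorm:
  assumes "sv_pair M s u v"
  shows "vnorm u = 1" "vnorm v = 1" "vnorm (M *\<^sub>v v) = \<bar>s\<bar>"
proof -
  show "vnorm u = 1" "vnorm v = 1" using assms by (auto simp: sv_pair_def vnorm_def)
  then show "vnorm (M *\<^sub>v v) = \<bar>s\<bar>" using assms by (simp add: sv_pair_def vnorm_smult)
qed

lemma sv_pair_gap:
  assumes M: "M \<in> carrier_mat n n" "1 \<le> n" and pair: "sv_pair M (sv_min M) u v"
    and simple: "simple_sv M (sv_min M)"
  obtains \<delta> where "\<delta> > 0"
    "\<And>z. z \<in> carrier_vec n \<Longrightarrow> z \<bullet>c v = 0 \<Longrightarrow> ((sv_min M)\<^sup>2 + \<delta>) * (vnorm z)\<^sup>2 \<le> (vnorm (M *\<^sub>v z))\<^sup>2"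
proof (rule simple_sv_min_gap[OF M(1) order_refl M(2) simple])
  show "v \<in> carrier_vec n" "vnorm v = 1"
    using pair M sv_pair_vnorm[OF pair] by (auto simp: sv_pair_def)
  have "mat_adjoint M *\<^sub>v (of_real (sv_min M) \<cdot>\<^sub>v u) = of_real (sv_min M) \<cdot>\<^sub>v (mat_adjoint M *\<^sub>v u)"
    using pair M by (intro mult_mat_vec[of _ n n]) (auto simp: sv_pair_def)
  then show "mat_adjoint M *\<^sub>v (M *\<^sub>v v) = of_real ((sv_min M)\<^sup>2) \<cdot>\<^sub>v v"
    using pair by (simp add: sv_pair_def smult_smult_assoc power2_eq_square)
qed (rule that)

text \<open>As \<open>V\<close> is an isometry onto \<open>S\<close>, \<open>sv_min (A * V)\<close>
  is the minimum of \<open>\<bar>A x\<bar>\<close> over the unit vectors of \<open>S\<close> only,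
  hence at least the minimum over all unit vectors; and \<open>v\<close> competes in it.\<close>

lemma reduced_sv_min_bounds:
  assumes A: "A \<in> carrier_mat n n" and "onb_mat n S V" "v \<in> S" "vnorm v = 1"
  shows "dim_col V \<le> n" "1 \<le> dim_col V"
    "sv_min A \<le> sv_min (A * V)" "sv_min (A * V) \<le> vnorm (A *\<^sub>v v)"
proof -
  define d where "d = dim_col V"
  have V: "V \<in> carrier_mat n d" and VV: "mat_adjoint V * V = 1\<^sub>m d"
    using \<open>onb_mat n S V\<close> unfolding onb_mat_def d_def by (blast intro: carrier_matI)+
  note ex = onb_mat_expand[OF assms(2,3), folded d_def]
  show dn: "dim_col V \<le> n" using isometry_dim_le[OF V VV] by (simp add: d_def)
  have d1: "1 \<le> d"
  proof (rule ccontr)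
    \<comment> \<open>Without columns the coordinate vector of \<open>v\<close> would be empty and
      have norm 0 instead of 1.\<close>
    assume "\<not> 1 \<le> d"
    then have "dim_col V = 0" by (simp add: d_def)
    then have "vnorm (mat_adjoint V *\<^sub>v v) = 0" by (simp add: vnorm_L2)
    then show False using ex(4) \<open>vnorm v = 1\<close> by simp
  qed
  then show "1 \<le> dim_col V" by (simp add: d_def)
  have AV: "A * V \<in> carrier_mat n d" using A V by simp
  have assoc: "(A * V) *\<^sub>v w = A *\<^sub>v (V *\<^sub>v w)" if "w \<in> carrier_vec d" for w
    using assoc_mult_mat_vec[OF A V that] .
  obtain w where w: "w \<in> carrier_vec d" "vnorm w = 1" "vnorm ((A * V) *\<^sub>v w) = sv_min (A * V)"
    using sv_min_attained[OF AV _ d1] dn unfolding d_def by blast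
  have "V *\<^sub>v w \<in> carrier_vec n" using V w by simp
  from sv_min_mult_le[OF A order_refl _ this] show "sv_min A \<le> sv_min (A * V)"
    using d1 dn w isometry_vnorm[OF V VV w(1)] assoc[OF w(1)] by (simp add: d_def)
  have "sv_min (A * V) * vnorm (mat_adjoint V *\<^sub>v v) \<le> vnorm ((A * V) *\<^sub>v (mat_adjoint V *\<^sub>v v))"
    using sv_min_mult_le[OF AV _ d1 ex(2)] dn by (simp add: d_def)
  also have "(A * V) *\<^sub>v (mat_adjoint V *\<^sub>v v) = A *\<^sub>v v"
    unfolding assoc[OF ex(2)] ex(1)[symmetric] ..
  finally show "sv_min (A * V) \<le> vnorm (A *\<^sub>v v)"
    using ex(4) \<open>vnorm v = 1\<close> by simp
qed

text \<open>\<open>\<beta>\<close> is any lower bound valid for all unit \<open>y\<close> that do at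
  least as well as \<open>v\<close>. A minimiser for \<open>A\<close> and the vector
  \<open>V w\<close> both qualify, whichever \<open>w\<close> was selected. Because \<open>u\<close>
  lies in \<open>SU\<close>, \<open>u\<^sup>* A V w\<close> is an inner product of coordinates along
  \<open>U\<close> and is at most \<open>\<bar>U\<^sup>* A V w\<bar>\<close>.\<close>

lemma reduced_lower_bounds:
  assumes A: "A \<in> carrier_mat n n"
    and V: "onb_mat n SV V" "v \<in> SV" "vnorm v = 1" and U: "onb_mat n SU U" "u \<in> SU" "vnorm u = 1"
    and w: "right_sv (A * V) (sv_min (A * V)) w"
    and \<beta>: "\<And>y. y \<in> carrier_vec n \<Longrightarrow> vnorm y = 1 \<Longrightarrow> vnorm (A *\<^sub>v y) \<le> vnorm (A *\<^sub>v v)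
               \<Longrightarrow> \<beta> \<le> cmod ((A *\<^sub>v y) \<bullet>c u)"
  shows "\<beta> \<le> sv_min A" "\<beta> \<le> sigma_VU A V U w" "sigma_VU A V U w \<le> sv_min (A * V)"
proof -
  define d where "d = dim_col V"
  define e where "e = dim_col U"
  have Vc: "V \<in> carrier_mat n d" and VV: "mat_adjoint V * V = 1\<^sub>m d"
    using V(1) unfolding onb_mat_def d_def by (blast intro: carrier_matI)+
  have Uc: "U \<in> carrier_mat n e" and UU: "mat_adjoint U * U = 1\<^sub>m e"
    using U(1) unfolding onb_mat_def e_def by (blast intro: carrier_matI)+
  note bnd = reduced_sv_min_bounds[OF A V]
  note exU = onb_mat_expand[OF U(1,2), folded e_def]
  have n1: "1 \<le> n" using bnd(1,2) by simp
  have CS: "cmod ((A *\<^sub>v y) \<bullet>c u) \<le> vnorm (A *\<^sub>v y)" if "y \<in> carrier_vec n" for y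
    using cip_Cauchy_Schwarz[of "A *\<^sub>v y" n u] A that exU(3) U(3) by simp
  obtain y where y: "y \<in> carrier_vec n" "vnorm y = 1" "vnorm (A *\<^sub>v y) = sv_min A"
    using sv_min_attained[OF A order_refl n1] by blast
  have "vnorm (A *\<^sub>v y) \<le> vnorm (A *\<^sub>v v)" using bnd(3,4) y(3) by simp
  from \<beta>[OF y(1,2) this] show "\<beta> \<le> sv_min A" using CS[OF y(1)] y(3) by simp
  obtain t where t: "sv_pair (A * V) (sv_min (A * V)) t w" using w by (auto simp: right_sv_def)
  have wc: "w \<in> carrier_vec d" and w1: "vnorm w = 1"
    using t sv_pair_vnorm[OF t] by (auto simp: sv_pair_def d_def)
  define z where "z = V *\<^sub>v w"
  have z: "z \<in> carrier_vec n" "vnorm z = 1"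
    using Vc wc isometry_vnorm[OF Vc VV wc] w1 by (auto simp: z_def)
  have AV: "A * V \<in> carrier_mat n d" using A Vc by simp
  have Az: "vnorm (A *\<^sub>v z) = sv_min (A * V)"
    using sv_pair_vnorm(3)[OF t] sv_min_nonneg[OF AV] bnd(1,2) assoc_mult_mat_vec[OF A Vc wc]
    by (simp add: z_def d_def)
  have Azc: "A *\<^sub>v z \<in> carrier_vec n" using A z by simp
  have sig: "sigma_VU A V U w = vnorm (mat_adjoint U *\<^sub>v (A *\<^sub>v z))"
    unfolding z_def by (rule sigma_VU_eq[OF A Vc Uc wc])
  show "sigma_VU A V U w \<le> sv_min (A * V)"
    unfolding sig using isometry_adjoint_vnorm_le[OF Uc UU Azc] Az by simp
  have "vnorm (A *\<^sub>v z) \<le> vnorm (A *\<^sub>v v)" using bnd(4) Az by simp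
  then have "\<beta> \<le> cmod ((A *\<^sub>v z) \<bullet>c u)" by (rule \<beta>[OF z])
  also have "(A *\<^sub>v z) \<bullet>c u = (mat_adjoint U *\<^sub>v (A *\<^sub>v z)) \<bullet>c (mat_adjoint U *\<^sub>v u)"
    using cip_adjoint[OF adjoint_carrier[OF Uc] Azc exU(2)] exU(1) by simp
  also have "cmod \<dots> \<le> vnorm (mat_adjoint U *\<^sub>v (A *\<^sub>v z)) * vnorm (mat_adjoint U *\<^sub>v u)"
    using Uc Azc exU(3) by (intro cip_Cauchy_Schwarz[of _ e] mult_mat_vec_carrier[OF adjoint_carrier])
  finally show "\<beta> \<le> sigma_VU A V U w" unfolding sig using exU(4) U(3) by simp
qed

subsection \<open>The greedy subspaces\<close>

text \<open>A sum of two sets contains each of them when both contain zero; hence zero is carried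
  through the induction.\<close>

lemma growing_subspaces:
  fixes S G :: "nat \<Rightarrow> cvec set"
  assumes S1: "S 1 = cspan n (G 1)"
    and grow: "\<And>j. 1 \<le> j \<Longrightarrow> S (j + 1) = subspace_plus (S j) (cspan n (G (j + 1)))"
    and G: "\<And>j. 1 \<le> j \<Longrightarrow> G j \<subseteq> carrier_vec n"
    and ij: "1 \<le> i" "i \<le> j" and g: "g \<in> G i"
  shows "g \<in> S j"
proof -
  have S: "0\<^sub>v n \<in> S j \<and> S j \<subseteq> carrier_vec n" if "1 \<le> j" for j
    using that
  proof (induction j rule: dec_induct)
    case base
    show ?case using cspan_zero cspan_carrier[OF G[OF order_refl]] unfolding S1 by blast
  next
    case (step j)
    then have IH: "0\<^sub>v n \<in> S j" "S j \<subseteq> carrier_vec n" and eq: "S (Suc j) = subspace_plus (S j) (cspan n (G (j + 1)))"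
      using grow[of j] by auto
    have "0\<^sub>v n + 0\<^sub>v n \<in> S (Suc j)"
      unfolding eq subspace_plus_def using IH(1) cspan_zero by blast
    moreover have "S (Suc j) \<subseteq> carrier_vec n"
      unfolding eq subspace_plus_def using IH(2) cspan_carrier[OF G[of "j + 1"]]
      by (auto intro!: add_carrier_vec)
    ultimately show ?case by simp
  qed
  have gc: "g \<in> cspan n (G i)" "g \<in> carrier_vec n"
    using cspan_superset[OF G[OF ij(1)] g] G[OF ij(1)] g by auto
  show ?thesis
    using ij(2)
  proof (induction j rule: dec_induct)
    case base
    show ?case
    \<comment> \<open>\<open>g\<close> enters either with the initial span or in the step from
      \<open>i - 1\<close> to \<open>i\<close>.\<close>
    proof (cases "i = 1")
      case True
      show ?thesis using gc(1) unfolding True S1 .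
    next
      case False
      then obtain k where k: "i = k + 1" "1 \<le> k" using ij(1) by (cases i) auto
      have "g = 0\<^sub>v n + g" using gc by simp
      then show ?thesis
        using grow[OF k(2)] S[OF k(2)] gc(1) unfolding k(1) subspace_plus_def by blast
    qed
  next
    case (step j)
    then have "g \<in> S j" "S (Suc j) = subspace_plus (S j) (cspan n (G (j + 1)))"
      using grow[of j] ij(1) by auto
    then have "g + 0\<^sub>v n \<in> S (Suc j)"
      unfolding subspace_plus_def using cspan_zero by blast
    then show ?case using gc(2) by simp
  qed
qed

subsection \<open>Gradients\<close>

text \<open>Near \<open>x0\<close> all three functions lie between \<open>lo\<close> and
  \<open>q\<close>, which agree and are differentiable at \<open>x0\<close>, so a single
  \<open>g\<close>, the gradient of \<open>q\<close>, serves for all of them.\<close>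

lemma reduced_singular_value_gradients:
  fixes A :: "'a :: euclidean_space \<Rightarrow> cmat"
  assumes A: "\<And>x. A x \<in> carrier_mat n n"
    and diff: "\<And>a b. a < n \<Longrightarrow> b < n \<Longrightarrow> (\<lambda>x. A x $$ (a, b)) differentiable (at x0)"
    and pair: "sv_pair (A x0) (sv_min (A x0)) u v"
    and simple: "simple_sv (A x0) (sv_min (A x0))" and nz: "sv_min (A x0) \<noteq> 0"
    and V: "onb_mat n SV V" "v \<in> SV" and U: "onb_mat n SU U" "u \<in> SU"
    and w: "\<And>x. right_sv (A x * V) (sv_min (A x * V)) (w x)"
  shows "\<exists>g. GDERIV (\<lambda>x. sv_min (A x)) x0 :> g \<and>
             GDERIV (\<lambda>x. sv_min (A x * V)) x0 :> g \<and>
             GDERIV (\<lambda>x. sigma_VU (A x) V U (w x)) x0 :> g"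
proof -
  define s where "s = sv_min (A x0)"
  note norms = sv_pair_vnorm[OF pair]
  note bnd = reduced_sv_min_bounds[OF A V norms(2)]
  have n1: "1 \<le> n" using bnd(1,2) by simp
  have s0: "0 < s" using sv_min_nonneg[OF A order_refl n1, of x0] nz by (simp add: s_def)
  have uv: "u \<in> carrier_vec n" "v \<in> carrier_vec n"
    and eqs: "A x0 *\<^sub>v v = of_real s \<cdot>\<^sub>v u" "mat_adjoint (A x0) *\<^sub>v u = of_real s \<cdot>\<^sub>v v"
    using pair A[of x0] by (auto simp: sv_pair_def s_def)
  obtain \<delta> where \<delta>: "\<delta> > 0"
    "\<And>z. z \<in> carrier_vec n \<Longrightarrow> z \<bullet>c v = 0 \<Longrightarrow> (s\<^sup>2 + \<delta>) * (vnorm z)\<^sup>2 \<le> (vnorm (A x0 *\<^sub>v z))\<^sup>2"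
    unfolding s_def using sv_pair_gap[OF A n1 pair simple] by blast
  define e where "e x = frob (A x - A x0)" for x
  \<comment> \<open>\<open>L\<close>, \<open>C\<close> and \<open>M\<close> are the constants in
    \<open>perturbed_lower_bound\<close>.\<close>
  define L where "L = 4 * (s + frob (A x0) + 1) / \<delta>"
  define C where "C = L\<^sup>2 * (s + 1) + L"
  define M where "M = 2 * frob (A x0) + 2 * s + 1"
  \<comment> \<open>The real part lies below the modulus and, unlike it, is linear in
    \<open>A x\<close>.\<close>
  define lo where "lo x = Re ((A x *\<^sub>v v) \<bullet>c u) - C * (e x)\<^sup>2" for x
  have M: "M > 0" using s0 frob_nonneg[of "A x0"] by (simp add: M_def add_nonneg_pos)
  have e2: "(\<lambda>x. (e x)\<^sup>2) differentiable (at x0)"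
    unfolding e_def by (rule differentiable_frob_sq[OF A diff])
  have dims: "dim_row (A x) = n" "dim_col (A x) = n" for x using A[of x] by auto
  have e_x0: "e x0 = 0" using dims by (simp add: e_def frob_def)
  \<comment> \<open>These are the smallness conditions of \<open>perturbed_lower_bound\<close>;
    continuity of \<open>e\<close> comes from that of its square.\<close>
  have ev: "eventually (\<lambda>x. e x < min 1 (\<delta> / 2 / M)) (nhds x0)"
  proof -
    have "isCont (\<lambda>x. sqrt ((e x)\<^sup>2)) x0"
      using differentiable_imp_continuous_within[OF e2] by (intro continuous_real_sqrt)
    moreover have "sqrt ((e x)\<^sup>2) = e x" for x by (simp add: e_def)
    ultimately have "isCont e x0" by simp
    then have "(e \<longlongrightarrow> e x0) (nhds x0)"
      unfolding isCont_def tendsto_at_iff_tendsto_nhds .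
    moreover have "e x0 < min 1 (\<delta> / 2 / M)" using \<delta>(1) M by (simp add: e_x0)
    ultimately show ?thesis by (rule order_tendstoD(2))
  qed
  have bounds: "eventually (\<lambda>x. lo x \<le> sv_min (A x) \<and> lo x \<le> sigma_VU (A x) V U (w x)) (nhds x0)"
    using ev
  proof eventually_elim
    case (elim x)
    then have small: "e x \<le> 1" "e x * M \<le> \<delta> / 2" using M by (auto simp: field_simps)
    have low: "lo x \<le> cmod ((A x *\<^sub>v y) \<bullet>c u)"
      if "y \<in> carrier_vec n" "vnorm y = 1" "vnorm (A x *\<^sub>v y) \<le> vnorm (A x *\<^sub>v v)" for y
    proof -
      have "cmod ((A x *\<^sub>v v) \<bullet>c u) - (L\<^sup>2 * (s + 1) + L) * (e x)\<^sup>2 \<le> cmod ((A x *\<^sub>v y) \<bullet>c u)"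
        using s0 small
        by (intro perturbed_lower_bound[OF A[of x0] A[of x] uv(1) norms(1) uv(2) norms(2) _ eqs \<delta>
              e_def _ _ L_def that]) (auto simp: M_def)
      then show ?thesis
        using complex_Re_le_cmod[of "(A x *\<^sub>v v) \<bullet>c u"] by (simp add: lo_def C_def)
    qed
    show ?case
      using reduced_lower_bounds(1,2)[OF A V norms(2) U norms(1) w[of x], of "lo x"] low by blast
  qed
  have Av: "(\<lambda>x. (A x *\<^sub>v v) $ i) differentiable (at x0)" if "i < n" for i
    by (rule differentiable_mult_mat_vec_index[OF A uv(2) that diff])
  have "(\<lambda>x. Re ((A x *\<^sub>v v) \<bullet>c u)) differentiable (at x0)"
    using uv(1) Av unfolding cip_sum
    by (intro differentiable_Re differentiable_sum differentiable_mult) auto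
  then have "lo differentiable (at x0)"
    unfolding lo_def by (intro differentiable_diff differentiable_mult e2) auto
  then obtain lo' where lo': "(lo has_derivative lo') (at x0)" by (auto simp: differentiable_def)
  define q where "q x = vnorm (A x *\<^sub>v v)" for x
  have q_x0: "q x0 = s" using norms(3) s0 by (simp add: q_def s_def)
  have "(\<lambda>x. (q x)\<^sup>2) differentiable (at x0)"
    unfolding q_def vnorm_sq_sum using Av dims
    by (auto intro!: differentiable_sum differentiable_cmod_sq)
  then obtain Q where "((\<lambda>x. (q x)\<^sup>2) has_derivative Q) (at x0)" by (auto simp: differentiable_def)
  \<comment> \<open>The square root is differentiable at \<open>(q x0)\<^sup>2 = s\<^sup>2\<close>
    because \<open>s > 0\<close>; here a nonzero singular value is decisive.\<close>
  then have "((\<lambda>x. sqrt ((q x)\<^sup>2)) has_derivative (\<lambda>h. Q h * (inverse (sqrt ((q x0)\<^sup>2)) / 2))) (at x0)"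
    using s0 q_x0 by (intro DERIV_compose_FDERIV[OF DERIV_real_sqrt]) auto
  moreover have "(\<lambda>x. sqrt ((q x)\<^sup>2)) = q" by (simp add: fun_eq_iff q_def)
  ultimately obtain q' where q': "(q has_derivative q') (at x0)" by metis
  have "(A x0 *\<^sub>v v) \<bullet>c u = of_real s"
    unfolding eqs(1) using uv norms(1) by (simp add: cip_smult_left[of _ n] cip_self)
  then have lo_x0: "lo x0 = q x0" by (simp add: lo_def e_x0 q_x0)
  \<comment> \<open>The upper bound on \<open>sigma_VU\<close> does not involve
    \<open>\<beta>\<close>, so the trivial lower bound 0 is inserted.\<close>
  have chain: "sv_min (A x) \<le> sv_min (A x * V)" "sv_min (A x * V) \<le> q x"
    "sigma_VU (A x) V U (w x) \<le> sv_min (A x * V)" for x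
    using reduced_sv_min_bounds(3,4)[OF A V norms(2), of x]
      reduced_lower_bounds(3)[OF A V norms(2) U norms(1) w[of x], of 0]
    by (auto simp: q_def)
  obtain g where g: "q' = (\<lambda>h. inner h g)" using has_derivative_imp_GDERIV[OF q'] .
  have sandwich: "GDERIV F x0 :> g" if "eventually (\<lambda>x. lo x \<le> F x \<and> F x \<le> q x) (nhds x0)" for F
    using has_derivative_sandwich[OF lo' q' lo_x0 that] unfolding g gderiv_def .
  have "GDERIV (\<lambda>x. sv_min (A x)) x0 :> g"
    by (rule sandwich, rule eventually_mono[OF bounds]) (use chain order_trans in blast)
  moreover have "GDERIV (\<lambda>x. sv_min (A x * V)) x0 :> g"
    by (rule sandwich, rule eventually_mono[OF bounds]) (use chain order_trans in blast)
  moreover have "GDERIV (\<lambda>x. sigma_VU (A x) V U (w x)) x0 :> g"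
    by (rule sandwich, rule eventually_mono[OF bounds]) (use chain order_trans in blast)
  ultimately show ?thesis by blast
qed

text \<open>The bounds \<open>sv_min A \<le> sv_min (A * V) \<le> \<bar>A v\<bar>\<close> close up,
  since \<open>\<bar>A v\<bar> = sv_min A\<close> for a right singular vector.\<close>

lemma sv_pair_interpolation:
  assumes A: "A \<in> carrier_mat n n" and pair: "sv_pair A (sv_min A) u v"
    and V: "onb_mat n SV V" "v \<in> SV"
  shows "sv_min (A * V) = sv_min A"
proof -
  note norms = sv_pair_vnorm[OF pair]
  note bnd = reduced_sv_min_bounds[OF A V norms(2)]
  show ?thesis
    using bnd norms(3) sv_min_nonneg[OF A order_refl] by auto
qed

text \<open>The unperturbed case \<open>e = 0\<close> of \<open>perturbed_lower_bound\<close> gives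
  the lower bound without error term; simplicity enters through the gap.\<close>

lemma sv_pair_two_sided_interpolation:
  assumes A: "A \<in> carrier_mat n n" and pair: "sv_pair A (sv_min A) u v"
    and simple: "simple_sv A (sv_min A)"
    and V: "onb_mat n SV V" "v \<in> SV" and U: "onb_mat n SU U" "u \<in> SU"
    and w: "right_sv (A * V) (sv_min (A * V)) w"
  shows "sigma_VU A V U w = sv_min A"
proof -
  define s where "s = sv_min A"
  note norms = sv_pair_vnorm[OF pair]
  note bnd = reduced_sv_min_bounds[OF A V norms(2)]
  have n1: "1 \<le> n" using bnd(1,2) by simp
  have s0: "0 \<le> s" using sv_min_nonneg[OF A order_refl n1] by (simp add: s_def)
  have uv: "u \<in> carrier_vec n" "v \<in> carrier_vec n"
    and eqs: "A *\<^sub>v v = of_real s \<cdot>\<^sub>v u" "mat_adjoint A *\<^sub>v u = of_real s \<cdot>\<^sub>v v"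
    using pair A by (auto simp: sv_pair_def s_def)
  obtain \<delta> where \<delta>: "\<delta> > 0"
    "\<And>z. z \<in> carrier_vec n \<Longrightarrow> z \<bullet>c v = 0 \<Longrightarrow> (s\<^sup>2 + \<delta>) * (vnorm z)\<^sup>2 \<le> (vnorm (A *\<^sub>v z))\<^sup>2"
    unfolding s_def using sv_pair_gap[OF A n1 pair simple] by blast
  have e0: "frob (A - A) = 0" using A by (simp add: frob_def)
  have Avu: "cmod ((A *\<^sub>v v) \<bullet>c u) = s"
    unfolding eqs(1) using uv norms(1) s0 by (simp add: cip_smult_left[of _ n] cip_self)
  have "s \<le> cmod ((A *\<^sub>v y) \<bullet>c u)"
    if "y \<in> carrier_vec n" "vnorm y = 1" "vnorm (A *\<^sub>v y) \<le> vnorm (A *\<^sub>v v)" for y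
    using perturbed_lower_bound[OF A A uv(1) norms(1) uv(2) norms(2) s0 eqs \<delta> e0[symmetric] _ _ refl that]
      \<delta>(1) Avu by simp
  from reduced_lower_bounds(2,3)[OF A V norms(2) U norms(1) w this]
  show ?thesis
    using sv_pair_interpolation[OF A pair V] by (simp add: s_def)
qed

theorem theorem5:
  fixes n l \<kappa> :: nat
    and D :: "(real ^ 'p) set"
    and \<theta> :: "nat \<Rightarrow> real ^ 'p \<Rightarrow> real"
    and Am :: "nat \<Rightarrow> complex Matrix.mat"
    and A :: "real ^ 'p \<Rightarrow> complex Matrix.mat"
    and u v :: "nat \<Rightarrow> real ^ 'p \<Rightarrow> complex Matrix.vec"
    and \<mu> :: "nat \<Rightarrow> real ^ 'p"
    and SV SU :: "nat \<Rightarrow> complex Matrix.vec set"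
    and V U :: "nat \<Rightarrow> complex Matrix.mat"
    and w :: "nat \<Rightarrow> real ^ 'p \<Rightarrow> complex Matrix.vec"
    and i j :: nat
  assumes "compact D"
    and "\<And>m. m \<in> {1..\<kappa>} \<Longrightarrow> Am m \<in> carrier_mat n n"
    and "\<And>m. m \<in> {1..\<kappa>} \<Longrightarrow> real_analytic (\<theta> m)"
    and "A = param_mat n \<kappa> \<theta> Am"
    and "1 \<le> l" and "l \<le> n"
    and "\<And>x k. x \<in> D \<Longrightarrow> k \<in> {1..l} \<Longrightarrow> sv_pair (A x) (sv k (A x)) (u k x) (v k x)"
    and "\<And>x. x \<in> D \<Longrightarrow> orthonormal_family l (\<lambda>k. u k x)"
    and "\<And>x. x \<in> D \<Longrightarrow> orthonormal_family l (\<lambda>k. v k x)"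
    and "two_sided_greedy n l D A u v \<mu> SV SU V U w"
    and "1 \<le> j" and "i \<in> {1..j}"
  shows "sv_min (A (\<mu> i) * V j) = sv_min (A (\<mu> i)) \<and>
    (simple_sv (A (\<mu> i)) (sv_min (A (\<mu> i))) \<longrightarrow>
      sigma_VU (A (\<mu> i)) (V j) (U j) (w j (\<mu> i)) = sv_min (A (\<mu> i))) \<and>
    (simple_sv (A (\<mu> i)) (sv_min (A (\<mu> i))) \<and> sv_min (A (\<mu> i)) \<noteq> 0 \<longrightarrow>
      (\<exists>g. GDERIV (\<lambda>x. sv_min (A x)) (\<mu> i) :> g \<and>
           GDERIV (\<lambda>x. sv_min (A x * V j)) (\<mu> i) :> g \<and>
           GDERIV (\<lambda>x. sigma_VU (A x) (V j) (U j) (w j x)) (\<mu> i) :> g))"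
proof -
  note greedy = \<open>two_sided_greedy n l D A u v \<mu> SV SU V U w\<close>[unfolded two_sided_greedy_def]
  note pair = assms(7)
  have A: "A x \<in> carrier_mat n n" for x by (simp add: assms(4))
  \<comment> \<open>Later points maximise over \<open>D\<close> and so lie in \<open>D\<close>,
    where the singular pairs are given.\<close>
  have \<mu>: "\<mu> k \<in> D" if k1: "1 \<le> k" for k
  proof (cases "k = 1")
    case False
    then obtain m where "k = m + 1" "1 \<le> m" using k1 by (cases k) auto
    then show ?thesis using greedy by (simp add: is_arg_max_def)
  qed (use greedy in simp)
  have vecs: "u k x \<in> carrier_vec n" "v k x \<in> carrier_vec n" if "x \<in> D" "k \<in> {1..l}" for k x
    using pair[OF that] A[of x] by (auto simp: sv_pair_def)
  have ij: "1 \<le> i" "i \<le> j" using \<open>i \<in> {1..j}\<close> by auto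
  have l1: "1 \<in> {1..l}" using \<open>1 \<le> l\<close> by simp
  \<comment> \<open>The vectors adjoined at \<open>\<mu> i\<close> stay in all later spaces.\<close>
  have vS: "v 1 (\<mu> i) \<in> SV j"
    by (rule growing_subspaces[of SV n "\<lambda>j. (\<lambda>k. v k (\<mu> j)) ` {1..l}" i j])
      (use greedy ij l1 \<mu> vecs in auto)
  have uS: "u 1 (\<mu> i) \<in> SU j"
    by (rule growing_subspaces[of SU n "\<lambda>j. (\<lambda>k. u k (\<mu> j)) ` {1..l}" i j])
      (use greedy ij l1 \<mu> vecs in auto)
  have V: "onb_mat n (SV j) (V j)" and U: "onb_mat n (SU j) (U j)"
    and w: "\<And>x. right_sv (A x * V j) (sv_min (A x * V j)) (w j x)"
    using greedy \<open>1 \<le> j\<close> by auto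
  \<comment> \<open>The smallest singular value is \<open>sv 1\<close>, so the first of the
    \<open>l\<close> pairs is the relevant one.\<close>
  have pair1: "sv_pair (A (\<mu> i)) (sv_min (A (\<mu> i))) (u 1 (\<mu> i)) (v 1 (\<mu> i))"
    using pair[OF \<mu>[OF ij(1)] l1] by (simp add: sv_min_def)
  have diff: "(\<lambda>x. A x $$ (a, b)) differentiable (at (\<mu> i))" if "a < n" "b < n" for a b
    unfolding assms(4) using assms(3) that by (rule param_mat_differentiable)
  show ?thesis
    using sv_pair_interpolation[OF A pair1 V vS]
      sv_pair_two_sided_interpolation[OF A pair1 _ V vS U uS w]
      reduced_singular_value_gradients[OF A diff pair1 _ _ V vS U uS w]
    by blast
qed

end
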